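(* Let $m\ge1$. For each $n\ge1$ let $P_m(w)$, $w\in S_n$, denote the probability that a shelf shuffle with $m$ shelves of $n$ cards produces $w$, and let $N_i(w)$ be the number of $i$-cycles of $w$. Then, as formal power series in $u,x_1,x_2,\dots$, \[ 1+\sum_{n\ge1}u^n\sum_{w\in S_n}P_m(w)\prod_{i\ge1}x_i^{N_i(w)}=\prod_{i\ge1}\left(\frac{1+x_i(u/2m)^i}{1-x_i(u/2m)^i}\right)^{f_{i,m}}, \] where $f_{i,m}=\frac{1}{2i}\sum_{d\mid i,\ d\text{ odd}}\mu(d)(2m)^{i/d}$ and $\mu$ is the Möbius function.
   Context: Shelf shuffle with $m$ shelves of a deck of $n$ cards, initially in order $1,\dots,n$ from top to bottom: each card independently gets a label uniform in $\{1,\dots,2m\}$; the new deck consists, from top to bottom, of the packets of cards with labels $1,2,\dots,2m$, the packet with label $j$ in increasing order if $j$ is odd and decreasing order if $j$ is even. The outcome is the permutation $w\in S_n$ with $w(i)$ the card in position $i$ from the top. *)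

theory Defs
  imports
    "HOL-Probability.Probability"
    "HOL-Computational_Algebra.Computational_Algebra"
    "HOL-Combinatorics.Orbits"
    "HOL-Combinatorics.Permutations"
    "HOL-Library.Poly_Mapping"
begin

subsection \<open>The shelf shuffle\<close>

definition packet :: "nat \<Rightarrow> (nat \<Rightarrow> nat) \<Rightarrow> nat \<Rightarrow> nat list" where
  "packet n l j =
     (let cs = filter (\<lambda>c. l c = j) [1..<Suc n] in if odd j then cs else rev cs)"

definition shelf_deck :: "nat \<Rightarrow> nat \<Rightarrow> (nat \<Rightarrow> nat) \<Rightarrow> nat list" where
  "shelf_deck m n l = concat (map (packet n l) [1..<Suc (2 * m)])"

text \<open>
  Positions are counted from 1 at the top.  Outside \<open>{1..n}\<close> the outcome is extended by the
  identity, so that elements of \<open>S\<^sub>n\<close> are the functions \<open>w\<close> with \<open>w permutes {1..n}\<close>.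
\<close>

definition shelf_outcome :: "nat \<Rightarrow> nat \<Rightarrow> (nat \<Rightarrow> nat) \<Rightarrow> nat \<Rightarrow> nat" where
  "shelf_outcome m n l i = (if i \<in> {1..n} then shelf_deck m n l ! (i - 1) else i)"

definition shelf_shuffle :: "nat \<Rightarrow> nat \<Rightarrow> (nat \<Rightarrow> nat) pmf" where
  "shelf_shuffle m n =
     map_pmf (shelf_outcome m n) (Pi_pmf {1..n} 0 (\<lambda>_. pmf_of_set {1..2 * m}))"

text \<open>
  Cycles are identified with their supports, fixed points included.  For \<open>w permutes {1..n}\<close> the
  value is 0 when \<open>i = 0\<close> or \<open>i > n\<close>.
\<close>

definition num_cycles :: "nat \<Rightarrow> (nat \<Rightarrow> nat) \<Rightarrow> nat \<Rightarrow> nat" where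
  "num_cycles n w i = card {C. \<exists>k\<in>{1..n}. C = orbit w k \<and> card C = i}"

subsection \<open>The exponents\<close>

definition moebius :: "nat \<Rightarrow> int" where
  "moebius d = (if squarefree d then (-1) ^ card (prime_factors d) else 0)"

definition shelf_exponent :: "nat \<Rightarrow> nat \<Rightarrow> real" where
  "shelf_exponent i m =
     1 / (2 * real i) * (\<Sum>d | d dvd i \<and> odd d. of_int (moebius d) * (2 * real m) ^ (i div d))"

subsection \<open>Formal power series\<close>

text \<open>
  A series in \<open>u, x\<^sub>1, x\<^sub>2, \<dots>\<close> whose coefficient of each power of \<open>u\<close> is a polynomial in the
  \<open>x\<^sub>i\<close> is an element of \<open>xpoly fps\<close>, with \<open>u\<close> rendered as \<open>fps_X\<close>.  A monomial in the \<open>x\<^sub>i\<close> is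
  its finitely supported exponent vector; the index 0 belongs to an unused variable.
\<close>

type_synonym xpoly = "(nat \<Rightarrow>\<^sub>0 nat) \<Rightarrow>\<^sub>0 real"

definition xvar :: "nat \<Rightarrow> xpoly" where
  "xvar i = Poly_Mapping.single (Poly_Mapping.single i 1) 1"

definition xconst :: "real \<Rightarrow> xpoly" where
  "xconst c = Poly_Mapping.single 0 c"

text \<open>
  Division in \<open>'a fps\<close> needs a division operation on the coefficients, which \<open>xpoly\<close> does not
  have.  Hence the reciprocal of a series with constant term 1 is given separately.
\<close>

definition fps_recip :: "xpoly fps \<Rightarrow> xpoly fps" where
  "fps_recip a = fps_right_inverse a 1"

lemma fps_mult_recip: "fps_nth a 0 = 1 \<Longrightarrow> a * fps_recip a = 1"
  unfolding fps_recip_def by (rule fps_right_inverse) simp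

text \<open>
  The power \<open>a\<^sup>r\<close>, for a series \<open>a\<close> with constant term 1, is the binomial series
  \<open>\<Sum>k. (r gchoose k) (a - 1)\<^sup>k\<close>.  So the exponent need not be known to be an integer; for
  natural exponents this is the usual power.
\<close>

definition fps_rpow :: "xpoly fps \<Rightarrow> real \<Rightarrow> xpoly fps" where
  "fps_rpow a r = fps_compose (Abs_fps (\<lambda>k. xconst (r gchoose k))) (a - 1)"

text \<open>The series \<open>x\<^sub>i (u / 2m)\<^sup>i\<close>:\<close>

definition cycle_term :: "nat \<Rightarrow> nat \<Rightarrow> xpoly fps" where
  "cycle_term m i =
     fps_const (xvar i) * (fps_const (xconst (1 / (2 * real m))) * fps_X) ^ i"

lemma xconst_of_nat: "xconst (of_nat k) = of_nat k"
  unfolding xconst_def by (induction k) (simp_all add: single_add)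

lemma fps_rpow_of_nat:
  assumes "fps_nth a 0 = 1"
  shows "fps_rpow a (of_nat k) = a ^ k"
proof -
  have *: "Abs_fps (\<lambda>j. xconst (of_nat k gchoose j)) = (1 + fps_X) ^ k"
  proof (rule fps_ext)
    fix j
    have "(1 + fps_X :: xpoly fps) ^ k = (\<Sum>i\<le>k. of_nat (k choose i) * fps_X ^ i)"
      using binomial_ring[of fps_X "1 :: xpoly fps" k] by (simp add: add.commute)
    also have "fps_nth \<dots> j = (\<Sum>i\<le>k. if i = j then of_nat (k choose i) else 0)"
      unfolding fps_sum_nth fps_of_nat[symmetric] fps_mult_left_const_nth fps_X_power_nth
      by (intro sum.cong) auto
    also have "\<dots> = of_nat (k choose j)"
      by (simp add: sum.delta not_le binomial_eq_0)
    finally show "fps_nth (Abs_fps (\<lambda>j. xconst (of_nat k gchoose j))) j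
        = fps_nth ((1 + fps_X) ^ k) j"
      by (simp add: binomial_gbinomial[symmetric] xconst_of_nat)
  qed
  have "fps_nth (a - 1) 0 = 0" using assms by simp
  then show ?thesis
    unfolding fps_rpow_def *
    by (simp add: fps_compose_power[symmetric] fps_compose_add_distrib)
qed

end

theory Submission
  imports Defs
begin

text \<open>
  For a labelling \<open>l\<close> of the cards with outcome \<open>w\<close>, attach to each card \<open>c\<close> the periodic word
  \<open>l c, l (w c), l (w\<^sup>2 c), \<dots>\<close>.  Each cycle of \<open>w\<close> then lies above a necklace, that is, a cyclic
  shift class of periodic words (the correspondence of Gessel and Reutenauer).  Give odd labels the
  sign 1 and even labels the sign -1.  Read along the positions, the words of the cards
  are sorted in a signed lexicographic order, so the multiset of these words determines \<open>l\<close>.  As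
  there are \<open>(2m)\<^sup>n\<close> multisets of necklaces of total length \<open>n\<close>, all of them occur.

  On the \<open>r\<close> cards with a given word of necklace length \<open>e\<close>, the power \<open>w\<^sup>e\<close> is monotone or antitone
  according to the sign of the necklace.  Hence it is the identity, with \<open>r\<close> cycles of length \<open>e\<close>
  above the necklace, or the order reversal, with \<open>r mod 2\<close> cycles of length \<open>e\<close> and \<open>r div 2\<close> of length
  \<open>2 e\<close>.  A necklace thus contributes \<open>1 / (1 - T\<^sub>e)\<close> or \<open>(1 + T\<^sub>e) / (1 - T\<^sub>2\<^sub>e)\<close>, where
  \<open>T\<^sub>i = x\<^sub>i (u / 2m)\<^sup>i\<close>.  With \<open>p\<^sub>e\<close> positive and \<open>q\<^sub>e\<close> negative necklaces of length \<open>e\<close>, the theorem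
  follows from \<open>q\<^sub>e = f\<^sub>e\<close> and, for even \<open>e\<close>, \<open>p\<^sub>e + q\<^sub>d = q\<^sub>e\<close> with \<open>d = e / 2\<close>
  (\<open>p\<^sub>e = q\<^sub>e\<close> for odd \<open>e\<close>), which come from summing the signs of all words of length \<open>e\<close>.
\<close>

subsection \<open>Orbits and necklaces\<close>

text \<open>The orbit size is the first return time \<open>funpow_dist1 f x x\<close>. The remainder
  of any return time modulo it is again a return time, but smaller than the first positive one,
  hence 0.\<close>

lemma card_orbit_period:
  assumes "x \<in> orbit f x"
  shows "(f ^^ n) x = x \<longleftrightarrow> card (orbit f x) dvd n"
    and "orbit f x = (\<lambda>k. (f ^^ k) x) ` {..<card (orbit f x)}"
    and "inj_on (\<lambda>k. (f ^^ k) x) {..<card (orbit f x)}"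
    and "0 < card (orbit f x)"
proof -
  define e where "e = funpow_dist1 f x x"
  have im: "orbit f x = (\<lambda>k. (f ^^ k) x) ` {..<e}"
    using orbit_conv_funpow_dist1[OF assms] by (simp add: e_def atLeast0LessThan)
  have inj: "inj_on (\<lambda>k. (f ^^ k) x) {..<e}"
    using inj_on_funpow_dist1[OF assms] by (simp add: e_def atLeast0LessThan)
  have card: "card (orbit f x) = e"
    unfolding im by (simp add: card_image[OF inj])
  have e: "(f ^^ e) x = x" "0 < e"
    using funpow_dist1_prop[OF assms] by (simp_all add: e_def)
  have "(f ^^ n) x = x \<longleftrightarrow> e dvd n"
  proof
    assume "(f ^^ n) x = x"
    then have "(f ^^ (n mod e)) x = x"
      using funpow_mod_eq[OF e(1)] by simp
    then have "n mod e = 0"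
      using funpow_dist1_least[of "n mod e" f x x] e(2) by (fastforce simp: e_def)
    then show "e dvd n" by auto
  next
    assume "e dvd n"
    then show "(f ^^ n) x = x"
      using funpow_mod_eq[OF e(1), of n] by simp
  qed
  with im inj card e show "(f ^^ n) x = x \<longleftrightarrow> card (orbit f x) dvd n"
    "orbit f x = (\<lambda>k. (f ^^ k) x) ` {..<card (orbit f x)}"
    "inj_on (\<lambda>k. (f ^^ k) x) {..<card (orbit f x)}" "0 < card (orbit f x)"
    by simp_all
qed

lemma self_in_orbitI: "(f ^^ n) x = x \<Longrightarrow> 0 < n \<Longrightarrow> x \<in> orbit f x"
  unfolding orbit_altdef by (force intro: exI[of _ n])

section \<open>Periodic words under the shift\<close>

definition wshift :: "(nat \<Rightarrow> 'a) \<Rightarrow> nat \<Rightarrow> 'a" where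
  "wshift x = (\<lambda>k. x (Suc k))"

lemma wshift_apply: "wshift x k = x (Suc k)"
  by (simp add: wshift_def)

lemma funpow_wshift: "(wshift ^^ n) x k = x (k + n)"
  by (induction n arbitrary: k) (auto simp: wshift_apply)

text \<open>Words are infinite sequences, so that rotating a finite word becomes applying
  \<open>wshift\<close>. The size of a cyclic shift class is the least period of its members; thus
  these are the primitive necklaces of length \<open>e\<close>, kept as the sets of their
  rotations.\<close>

definition necklaces :: "nat \<Rightarrow> nat \<Rightarrow> (nat \<Rightarrow> nat) set set" where
  "necklaces K e = {N. cyclic_on wshift N \<and> N \<subseteq> {x. \<forall>k. x k \<in> {1..K}} \<and> card N = e}"

text \<open>The period \<open>i\<close> need not be the least one: for \<open>i \<ge> 1\<close>
  these words stand for all words of length \<open>i\<close>.\<close>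

definition periodic_words :: "nat \<Rightarrow> nat \<Rightarrow> (nat \<Rightarrow> nat) set" where
  "periodic_words K i = {x. (\<forall>k. x k \<in> {1..K}) \<and> (wshift ^^ i) x = x}"

lemma bij_betw_periodic_words:
  assumes "i \<ge> 1"
  shows "bij_betw (\<lambda>x. restrict x {..<i}) (periodic_words K i) ({..<i} \<rightarrow>\<^sub>E {1..K})"
proof (rule bij_betwI[where g = "\<lambda>g k. g (k mod i)"])
  show "(\<lambda>x. restrict x {..<i}) \<in> periodic_words K i \<rightarrow> {..<i} \<rightarrow>\<^sub>E {1..K}"
    by (auto simp: periodic_words_def)
  show "(\<lambda>g k. g (k mod i)) \<in> ({..<i} \<rightarrow>\<^sub>E {1..K}) \<rightarrow> periodic_words K i"
  proof
    fix g assume g: "g \<in> {..<i} \<rightarrow>\<^sub>E {1..K}"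
    have "g (k mod i) \<in> {1..K}" for k
      using g assms by (auto simp: PiE_iff)
    then show "(\<lambda>k. g (k mod i)) \<in> periodic_words K i"
      by (auto simp: periodic_words_def fun_eq_iff funpow_wshift)
  qed
  fix x assume x: "x \<in> periodic_words K i"
  have "x k = x (k mod i)" for k
  proof -
    have "(wshift ^^ (i * t)) x = x" for t
      using x by (induction t) (auto simp: periodic_words_def funpow_add)
    from fun_cong[OF this[of "k div i"], of "k mod i"] show ?thesis
      by (simp add: funpow_wshift)
  qed
  then show "(\<lambda>k. restrict x {..<i} (k mod i)) = x"
    using assms by (auto simp: fun_eq_iff)
next
  fix g assume "g \<in> {..<i} \<rightarrow>\<^sub>E {1..K}"
  then show "restrict (\<lambda>k. g (k mod i)) {..<i} = g"
    by (auto simp: fun_eq_iff PiE_iff extensional_def)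
qed

lemma sum_periodic_words:
  fixes h :: "nat \<Rightarrow> 'a::comm_semiring_1"
  assumes "i \<ge> 1"
  shows "(\<Sum>x\<in>periodic_words K i. \<Prod>k<i. h (x k)) = (\<Sum>j=1..K. h j) ^ i"
proof -
  have "(\<Sum>j=1..K. h j) ^ i = (\<Prod>k<i. \<Sum>j=1..K. h j)"
    by simp
  also have "\<dots> = (\<Sum>g\<in>{..<i} \<rightarrow>\<^sub>E {1..K}. \<Prod>k<i. h (g k))"
    by (rule prod_sum_PiE) auto
  also have "\<dots> = (\<Sum>x\<in>periodic_words K i. \<Prod>k<i. h (restrict x {..<i} k))"
    by (rule sum.reindex_bij_betw[OF bij_betw_periodic_words[OF assms], symmetric])
  also have "\<dots> = (\<Sum>x\<in>periodic_words K i. \<Prod>k<i. h (x k))"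
    by (intro sum.cong prod.cong) auto
  finally show ?thesis by simp
qed

lemma finite_periodic_words: "i \<ge> 1 \<Longrightarrow> finite (periodic_words K i)"
  using bij_betw_finite[OF bij_betw_periodic_words[of i K]] by (simp add: finite_PiE)

lemma necklacesD:
  assumes "N \<in> necklaces K e" "x \<in> N"
  shows "orbit wshift x = N" "x \<in> orbit wshift x" "wshift x \<in> N" "finite N" "card N = e" "0 < e"
    "x k \<in> {1..K}"
proof -
  have c: "cyclic_on wshift N" using assms by (auto simp: necklaces_def)
  show "orbit wshift x = N" using c assms by (simp add: orbit_cyclic_eq3)
  then show "x \<in> orbit wshift x" using assms by simp
  show "wshift x \<in> N" "finite N" using c assms by (simp_all add: cyclic_on_inI finite_cyclic_on)
  show "card N = e" using assms by (simp add: necklaces_def)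
  then show "0 < e" using \<open>finite N\<close> assms(2) by (auto simp: card_gt_0_iff)
  show "x k \<in> {1..K}" using assms by (auto simp: necklaces_def)
qed

lemma necklaces_nonempty: "N \<in> necklaces K e \<Longrightarrow> N \<noteq> {}"
  by (auto simp: necklaces_def cyclic_on_alldef)

lemma orbit_wshift_in_necklaces:
  assumes "\<And>k. x k \<in> {1..K}" "x \<in> orbit wshift x"
  shows "orbit wshift x \<in> necklaces K (card (orbit wshift x))"
proof -
  have "y \<in> {x. \<forall>k. x k \<in> {1..K}}" if y: "y \<in> orbit wshift x" for y
  proof -
    obtain n where "y = (wshift ^^ n) x" using y by (auto simp: orbit_altdef)
    then show ?thesis using assms(1) by (auto simp: funpow_wshift)
  qed
  then show ?thesis
    using assms(2) unfolding necklaces_def by (auto simp: cyclic_on_def)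
qed

text \<open>The words of \<open>N\<close> are the first \<open>e\<close> shifts of \<open>x\<close>,
  and their first letters are the letters of one period of \<open>x\<close>.\<close>

lemma prod_necklace:
  fixes h :: "nat \<Rightarrow> 'a::comm_semiring_1"
  assumes "N \<in> necklaces K e" "x \<in> N"
  shows "(\<Prod>y\<in>N. h (y 0)) = (\<Prod>k<e. h (x k))"
proof -
  note N = necklacesD[OF assms]
  have "(\<Prod>y\<in>N. h (y 0)) = (\<Prod>y\<in>(\<lambda>k. (wshift ^^ k) x) ` {..<e}. h (y 0))"
    using card_orbit_period(2)[OF N(2)] N by simp
  also have "\<dots> = (\<Prod>k<e. h ((wshift ^^ k) x 0))"
    using card_orbit_period(3)[OF N(2)] N by (subst prod.reindex) (auto simp: o_def)
  finally show ?thesis by (simp add: funpow_wshift)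
qed

lemma prod_necklace_power:
  fixes h :: "nat \<Rightarrow> 'a::comm_semiring_1"
  assumes "N \<in> necklaces K e" "x \<in> N" "e dvd i"
  shows "(\<Prod>k<i. h (x k)) = (\<Prod>y\<in>N. h (y 0)) ^ (i div e)"
proof -
  note N = necklacesD[OF assms(1,2)]
  have "(wshift ^^ (t * e)) x = x" for t
    using card_orbit_period(1)[OF N(2), of "t * e"] N by simp
  then have per: "x (k + t * e) = x k" for k t
    by (metis funpow_wshift)
  have "(\<Prod>k<i. h (x k)) = (\<Prod>k<(i div e) * e. h (x k))"
    using assms by simp
  also have "\<dots> = (\<Prod>t<i div e. \<Prod>k=t*e..<t*e+e. h (x k))"
    by (rule prod.nat_group[symmetric])
  also have "\<dots> = (\<Prod>t<i div e. \<Prod>k<e. h (x k))"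
  proof (rule prod.cong)
    fix t
    have "(\<Prod>k=t*e..<t*e+e. h (x k)) = (\<Prod>k=0+t*e..<e+t*e. h (x k))"
      by (simp add: add.commute)
    also have "\<dots> = (\<Prod>k=0..<e. h (x (k + t * e)))"
      by (rule prod.shift_bounds_nat_ivl)
    finally show "(\<Prod>k=t*e..<t*e+e. h (x k)) = (\<Prod>k<e. h (x k))"
      by (simp add: per atLeast0LessThan)
  qed simp
  finally show ?thesis by (simp add: prod_necklace[OF assms(1,2)])
qed

lemma finite_necklaces: "finite (necklaces K e)"
proof (cases "e = 0")
  case True
  then have "necklaces K e = {}"
    using necklacesD(6) necklaces_nonempty by fastforce
  then show ?thesis by simp
next
  case False
  have "necklaces K e \<subseteq> orbit wshift ` periodic_words K e"
  proof
    fix N assume N: "N \<in> necklaces K e"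
    then obtain x where x: "x \<in> N" using necklaces_nonempty by fastforce
    note D = necklacesD[OF N x]
    have "x \<in> periodic_words K e"
      using D card_orbit_period(1)[OF D(2), of e] by (auto simp: periodic_words_def)
    with D(1) show "N \<in> orbit wshift ` periodic_words K e" by blast
  qed
  then show ?thesis using finite_periodic_words[of e K] False
    by (auto intro: finite_subset)
qed

lemma necklaces_eq_size: "N \<in> necklaces K e \<Longrightarrow> card N = e"
  by (simp add: necklaces_def)

text \<open>Expanding the power gives a sum over all words of period \<open>i\<close>. Group them by
  shift class: a class of size \<open>e\<close> dividing \<open>i\<close> contains \<open>e\<close>
  such words, and each runs \<open>i div e\<close> times through the letters of the class.\<close>

lemma sum_necklaces:
  fixes h :: "nat \<Rightarrow> 'a::comm_semiring_1"
  assumes "i \<ge> 1"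
  shows "(\<Sum>e | e dvd i. \<Sum>N\<in>necklaces K e. of_nat e * (\<Prod>x\<in>N. h (x 0)) ^ (i div e))
    = (\<Sum>j=1..K. h j) ^ i"
proof -
  define T where "T = (\<Union>e\<in>{e. e dvd i}. necklaces K e)"
  have fin: "finite {e. e dvd i}" using assms by (auto intro: finite_divisors_nat)
  have "finite T" unfolding T_def using fin finite_necklaces by blast
  have fib: "{x \<in> periodic_words K i. orbit wshift x = N} = N" if "N \<in> necklaces K e" "e dvd i" for N e
  proof (intro equalityI subsetI)
    fix x assume "x \<in> N"
    note D = necklacesD[OF that(1) this]
    show "x \<in> {x \<in> periodic_words K i. orbit wshift x = N}"
      using D card_orbit_period(1)[OF D(2), of i] that by (auto simp: periodic_words_def)
  next
    fix x assume "x \<in> {x \<in> periodic_words K i. orbit wshift x = N}"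
    then show "x \<in> N" using assms self_in_orbitI[of i wshift x] by (auto simp: periodic_words_def)
  qed
  have im: "orbit wshift ` periodic_words K i \<subseteq> T"
  proof
    fix N assume "N \<in> orbit wshift ` periodic_words K i"
    then obtain x where x: "N = orbit wshift x" "\<And>k. x k \<in> {1..K}" "(wshift ^^ i) x = x"
      by (auto simp: periodic_words_def)
    then have "x \<in> orbit wshift x" using assms by (auto intro: self_in_orbitI)
    then show "N \<in> T"
      unfolding T_def using x orbit_wshift_in_necklaces[of x K]
        card_orbit_period(1)[of x wshift i] by auto
  qed
  have "(\<Sum>j=1..K. h j) ^ i = (\<Sum>x\<in>periodic_words K i. \<Prod>k<i. h (x k))"
    by (rule sum_periodic_words[OF assms, symmetric])
  also have "\<dots> = (\<Sum>N\<in>T. \<Sum>x | x \<in> periodic_words K i \<and> orbit wshift x = N. \<Prod>k<i. h (x k))"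
    using sum.group[OF finite_periodic_words[OF assms] \<open>finite T\<close> im] by (rule sym)
  also have "\<dots> = (\<Sum>e | e dvd i. \<Sum>N\<in>necklaces K e. \<Sum>x | x \<in> periodic_words K i \<and> orbit wshift x = N. \<Prod>k<i. h (x k))"
    unfolding T_def using fin finite_necklaces
    by (intro sum.UNION_disjoint) (auto simp: necklaces_def)
  also have "\<dots> = (\<Sum>e | e dvd i. \<Sum>N\<in>necklaces K e. of_nat e * (\<Prod>x\<in>N. h (x 0)) ^ (i div e))"
  proof (intro sum.cong refl)
    fix e N assume e: "e \<in> {e. e dvd i}" and N: "N \<in> necklaces K e"
    have "(\<Sum>x | x \<in> periodic_words K i \<and> orbit wshift x = N. \<Prod>k<i. h (x k))
      = (\<Sum>x\<in>N. (\<Prod>x\<in>N. h (x 0)) ^ (i div e))"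
      using e fib[OF N] prod_necklace_power[OF N, of _ i h] by (intro sum.cong) auto
    then show "(\<Sum>x | x \<in> periodic_words K i \<and> orbit wshift x = N. \<Prod>k<i. h (x k))
      = of_nat e * (\<Prod>x\<in>N. h (x 0)) ^ (i div e)"
      using N by (simp add: necklaces_eq_size)
  qed
  finally show ?thesis ..
qed

subsection \<open>The exponents count negative necklaces\<close>

lemma moebius_mult_prime:
  assumes "prime p" "\<not> p dvd d"
  shows "moebius (p * d) = - moebius d"
proof -
  have cop: "coprime p d" using assms by (simp add: prime_imp_coprime)
  have sf: "squarefree (p * d) \<longleftrightarrow> squarefree d"
    using assms(1) by (auto simp: squarefree_mult_coprime[OF cop] squarefree_prime dest: squarefree_multD)
  have "d \<noteq> 0" using assms(2) by (intro notI) auto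
  then have "prime_factors (p * d) = insert p (prime_factors d)"
    using assms(1) by (auto simp: prime_factors_product prime_prime_factors)
  moreover have "p \<notin> prime_factors d" using assms(2) by auto
  ultimately have "card (prime_factors (p * d)) = Suc (card (prime_factors d))"
    by simp
  then show ?thesis by (simp add: moebius_def sf)
qed

text \<open>A prime \<open>p\<close> dividing \<open>t\<close> pairs each divisor \<open>d\<close>
  not divisible by \<open>p\<close> with \<open>p * d\<close>, which has the opposite Moebius value.
  Multiples of \<open>p\<^sup>2\<close> contribute 0.\<close>

lemma sum_moebius_divisors:
  fixes t :: nat
  assumes "t \<ge> 1"
  shows "(\<Sum>d | d dvd t. moebius d) = (if t = 1 then 1 else 0)"
proof (cases "t = 1")
  case True
  then show ?thesis by (simp add: moebius_def)
next
  case False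
  then obtain p where p: "prime p" "p dvd t" using prime_factor_nat by blast
  define A where "A = {d. d dvd t \<and> \<not> p dvd d}"
  define B where "B = {d. d dvd t \<and> p dvd d \<and> \<not> p\<^sup>2 dvd d}"
  have fin: "finite {d. d dvd t}" using assms by (auto intro: finite_divisors_nat)
  have "(\<Sum>d | d dvd t. moebius d) = (\<Sum>d\<in>A \<union> B. moebius d)"
  proof (rule sum.mono_neutral_right[OF fin])
    show "\<forall>d\<in>{d. d dvd t} - (A \<union> B). moebius d = 0"
      using p(1) by (auto simp: A_def B_def moebius_def squarefree_def)
  qed (auto simp: A_def B_def)
  also have "\<dots> = (\<Sum>d\<in>A. moebius d) + (\<Sum>d\<in>B. moebius d)"
    by (rule sum.union_disjoint) (use fin in \<open>auto simp: A_def B_def elim: finite_subset[rotated]\<close>)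
  also have "(\<Sum>d\<in>B. moebius d) = (\<Sum>d\<in>A. moebius (p * d))"
  proof (rule sum.reindex_bij_witness[of _ "\<lambda>d. p * d" "\<lambda>d. d div p"])
    fix d assume "d \<in> B"
    then show "p * (d div p) = d" "d div p \<in> A" "moebius (p * (d div p)) = moebius d"
      using p(1) by (auto simp: A_def B_def power2_eq_square elim!: dvdE intro: dvd_mult_left)
  next
    fix d assume d: "d \<in> A"
    show "p * d div p = d" using p(1) by (auto simp: prime_gt_0_nat)
    have "coprime p d" using p(1) d by (simp add: A_def prime_imp_coprime)
    then show "p * d \<in> B"
      using d p by (auto simp: A_def B_def power2_eq_square divides_mult prime_gt_0_nat)
  qed
  also have "\<dots> = (\<Sum>d\<in>A. - moebius d)"
    by (intro sum.cong moebius_mult_prime p(1)) (auto simp: A_def)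
  finally show ?thesis using False by (simp add: sum_negf)
qed

text \<open>Insert the formula for \<open>G\<close> and collect the terms by the product
  \<open>t = d * d'\<close>. Since a product is odd exactly when both factors are, \<open>d\<close>
  then runs over all divisors of the odd number \<open>t\<close>, and the Moebius sum leaves only
  \<open>t = 1\<close>.\<close>

lemma odd_moebius_inversion:
  fixes Q G :: "nat \<Rightarrow> 'a::comm_ring_1"
  assumes G: "\<And>i. i \<ge> 1 \<Longrightarrow> G i = (\<Sum>d | d dvd i \<and> odd d. Q (i div d))" and "i \<ge> 1"
  shows "(\<Sum>d | d dvd i \<and> odd d. of_int (moebius d) * G (i div d)) = Q i"
proof -
  define P where "P = (\<lambda>d::nat. odd d)"
  have P_mult: "P (a * b) \<longleftrightarrow> P a \<and> P b" for a b by (simp add: P_def)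
  define D where "D i = {d. d dvd i \<and> P d}" for i :: nat
  have fin: "finite (D i)" if "i \<ge> 1" for i
    using that by (auto simp: D_def intro: finite_subset[OF _ finite_divisors_nat[of i]])
  have quot: "1 \<le> i div d" if "d \<in> D i" for d
    using that assms(2) by (auto simp: D_def dvd_imp_le div_greater_zero_iff Suc_le_eq intro!: gr0I)
  have "(\<Sum>d\<in>D i. of_int (moebius d) * G (i div d))
      = (\<Sum>d\<in>D i. \<Sum>d'\<in>D (i div d). of_int (moebius d) * Q (i div d div d'))"
    by (intro sum.cong refl) (simp add: G[OF quot] D_def[of "_ div _"] P_def sum_distrib_left)
  also have "\<dots> = (\<Sum>(d, d')\<in>(SIGMA d:D i. D (i div d)). of_int (moebius d) * Q (i div d div d'))"
    using fin[OF assms(2)] fin[OF quot] by (intro sum.Sigma) simp_all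
  also have "\<dots> = (\<Sum>(t, d)\<in>(SIGMA t:D i. {d. d dvd t}). of_int (moebius d) * Q (i div t))"
  proof (rule sum.reindex_bij_witness[of _ "\<lambda>(t, d). (d, t div d)" "\<lambda>(d, d'). (d * d', d)"])
    fix a assume "a \<in> (SIGMA d:D i. D (i div d))"
    then obtain d d' where a: "a = (d, d')" "d dvd i" "d' dvd i div d" "P d" "P d'"
      by (auto simp: D_def)
    moreover have "d > 0" using a(2) assms(2) by (auto intro: gr0I)
    moreover have "i div (d * d') = i div d div d'" by (rule div_mult2_eq)
    ultimately show "(case case a of (d, d') \<Rightarrow> (d * d', d) of (t, d) \<Rightarrow> (d, t div d)) = a"
      "(case a of (d, d') \<Rightarrow> (d * d', d)) \<in> (SIGMA t:D i. {d. d dvd t})"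
      "(case case a of (d, d') \<Rightarrow> (d * d', d) of (t, d) \<Rightarrow> of_int (moebius d) * Q (i div t))
        = (case a of (d, d') \<Rightarrow> of_int (moebius d) * Q (i div d div d'))"
      by (simp_all add: D_def P_mult dvd_div_iff_mult mult.commute[of d' d])
  next
    fix b assume "b \<in> (SIGMA t:D i. {d. d dvd t})"
    then obtain t d where b: "b = (t, d)" "t dvd i" "P t" "d dvd t"
      by (auto simp: D_def)
    then have "P (d * (t div d))" "d dvd i" by (auto intro: dvd_trans)
    with b show "(case case b of (t, d) \<Rightarrow> (d, t div d) of (d, d') \<Rightarrow> (d * d', d)) = b"
      "(case b of (t, d) \<Rightarrow> (d, t div d)) \<in> (SIGMA d:D i. D (i div d))"
      unfolding P_mult by (simp_all add: D_def)
  qed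
  also have "\<dots> = (\<Sum>t\<in>D i. \<Sum>d | d dvd t. of_int (moebius d) * Q (i div t))"
  proof (rule sum.Sigma[symmetric])
    show "\<forall>t\<in>D i. finite {d. d dvd t}"
      using assms(2) by (metis D_def finite_divisors_nat dvd_pos_nat less_eq_Suc_le One_nat_def mem_Collect_eq)
  qed (rule fin[OF assms(2)])
  also have "\<dots> = (\<Sum>t\<in>D i. of_int (\<Sum>d | d dvd t. moebius d) * Q (i div t))"
    by (simp add: sum_distrib_right)
  also have "\<dots> = (\<Sum>t\<in>D i. if t = 1 then Q i else 0)"
    by (intro sum.cong refl) (simp add: sum_moebius_divisors D_def P_def odd_pos Suc_le_eq)
  also have "\<dots> = Q i"
    using fin[OF assms(2)] by (simp add: D_def P_def)
  finally show ?thesis by (simp add: D_def P_def)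
qed

text \<open>Strong induction: all divisors other than \<open>i\<close> itself are smaller, so their
  terms agree already.\<close>

lemma divisor_sum_unique:
  fixes A B :: "nat \<Rightarrow> 'a::ab_group_add"
  assumes "\<And>i. i \<ge> 1 \<Longrightarrow> (\<Sum>e | e dvd i. A e) = (\<Sum>e | e dvd i. B e)" and "i \<ge> 1"
  shows "A i = B i"
  using assms(2)
proof (induction i rule: less_induct)
  case (less i)
  have fin: "finite {e. e dvd i}" using less.prems by (auto intro: finite_divisors_nat)
  have "(\<Sum>e | e dvd i. F e) = F i + (\<Sum>e\<in>{e. e dvd i} - {i}. F e)" for F :: "nat \<Rightarrow> 'a"
    using fin by (intro sum.remove) auto
  moreover have "(\<Sum>e\<in>{e. e dvd i} - {i}. A e) = (\<Sum>e\<in>{e. e dvd i} - {i}. B e)"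
  proof (intro sum.cong refl less.IH)
    fix e assume e: "e \<in> {e. e dvd i} - {i}"
    then show "e < i" using less.prems by (auto dest: dvd_imp_le)
    show "1 \<le> e" using e less.prems by (auto simp: Suc_le_eq intro!: gr0I)
  qed
  ultimately show ?case using assms(1)[OF less.prems] by simp
qed

section \<open>Signs of necklaces\<close>

text \<open>The sign tells whether the packet with this label keeps or reverses the order of its
  cards.\<close>

definition letter_sign :: "nat \<Rightarrow> int" where
  "letter_sign j = (if odd j then 1 else -1)"

text \<open>By \<open>prod_necklace\<close> this is the sign of the finite word read once around the
  necklace.\<close>

definition neck_sign :: "(nat \<Rightarrow> nat) set \<Rightarrow> int" where
  "neck_sign N = (\<Prod>x\<in>N. letter_sign (x 0))"

definition signed_necklaces :: "nat \<Rightarrow> nat \<Rightarrow> int \<Rightarrow> (nat \<Rightarrow> nat) set set" where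
  "signed_necklaces K e s = {N \<in> necklaces K e. neck_sign N = s}"

lemma prod_letter_sign_cases: "(\<Prod>x\<in>A. letter_sign (g x)) = 1 \<or> (\<Prod>x\<in>A. letter_sign (g x)) = -1"
  by (induction A rule: infinite_finite_induct) (auto simp: letter_sign_def)

lemma neck_sign_cases: "neck_sign N = 1 \<or> neck_sign N = -1"
  unfolding neck_sign_def by (rule prod_letter_sign_cases)

lemma sum_signed_necklaces:
  fixes F :: "_ \<Rightarrow> 'a::comm_monoid_add"
  shows "(\<Sum>N\<in>necklaces K e. F N)
    = (\<Sum>N\<in>signed_necklaces K e 1. F N) + (\<Sum>N\<in>signed_necklaces K e (-1). F N)"
proof -
  have "necklaces K e = signed_necklaces K e 1 \<union> signed_necklaces K e (-1)"
    using neck_sign_cases by (auto simp: signed_necklaces_def)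
  moreover have "finite (signed_necklaces K e s)" for s
    by (simp add: signed_necklaces_def finite_necklaces)
  moreover have "signed_necklaces K e 1 \<inter> signed_necklaces K e (-1) = {}"
    by (auto simp: signed_necklaces_def)
  ultimately show ?thesis
    by (simp add: sum.union_disjoint)
qed

lemma sum_letter_sign: "(\<Sum>j=1..2 * m. letter_sign j) = 0"
  by (induction m) (auto simp: letter_sign_def)

text \<open>Both are instances of \<open>sum_necklaces\<close>: with all letters of weight 1, and
  with the letters weighted by sign. For even \<open>K\<close> the signs of the letters add up to
  0.\<close>

lemma necklace_counts:
  fixes K :: nat
  defines "p \<equiv> \<lambda>e. int (card (signed_necklaces K e 1))"
    and "q \<equiv> \<lambda>e. int (card (signed_necklaces K e (-1)))"
  assumes "i \<ge> 1"
  shows "(\<Sum>e | e dvd i. int e * (p e + q e)) = int K ^ i"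
    and "even K \<Longrightarrow> (\<Sum>e | e dvd i. int e * (p e + (-1) ^ (i div e) * q e)) = 0"
proof -
  show "(\<Sum>e | e dvd i. int e * (p e + q e)) = int K ^ i"
  proof -
    have "int (card (necklaces K e)) = p e + q e" for e
      using sum_signed_necklaces[of "\<lambda>_. 1 :: int" K e] by (simp add: p_def q_def)
    then show ?thesis
      using sum_necklaces[OF assms(3), where K = K and h = "\<lambda>_. 1 :: int"]
      by (simp add: mult.commute)
  qed
  show "(\<Sum>e | e dvd i. int e * (p e + (-1) ^ (i div e) * q e)) = 0" if "even K"
  proof -
    have "(\<Sum>N\<in>necklaces K e. int e * (\<Prod>x\<in>N. letter_sign (x 0)) ^ (i div e))
        = int e * (p e + (-1) ^ (i div e) * q e)" for e
    proof -
      have *: "(\<Sum>N\<in>signed_necklaces K e s. int e * (\<Prod>x\<in>N. letter_sign (x 0)) ^ (i div e))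
          = (\<Sum>N\<in>signed_necklaces K e s. int e * s ^ (i div e))" for s
        by (intro sum.cong) (auto simp: signed_necklaces_def neck_sign_def)
      show ?thesis
        unfolding sum_signed_necklaces * by (simp add: p_def q_def algebra_simps)
    qed
    moreover obtain m where "K = 2 * m" using \<open>even K\<close> by blast
    then have "(\<Sum>j=1..K. letter_sign j) = 0"
      using sum_letter_sign[of m] by simp
    moreover have "(0 :: int) ^ i = 0" using assms(3) by simp
    ultimately show ?thesis
      using sum_necklaces[OF assms(3), where K = K and h = letter_sign]
      by (simp only: of_nat_id)
  qed
qed

text \<open>Subtracting the signed count from the unsigned one leaves the negative necklaces whose
  length \<open>e\<close> has an odd quotient \<open>i div e\<close>, with weight
  \<open>2 * e\<close>. This writes \<open>(2 * m) ^ i\<close> as a sum over odd divisors, which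
  Moebius inversion solves for \<open>2 * i * q i\<close>.\<close>

lemma card_negative_necklaces:
  assumes "i \<ge> 1"
  shows "shelf_exponent i m = real (card (signed_necklaces (2 * m) i (-1)))"
proof -
  define p where "p = (\<lambda>e. int (card (signed_necklaces (2 * m) e 1)))"
  define q where "q = (\<lambda>e. int (card (signed_necklaces (2 * m) e (-1))))"
  have *: "(2 * real m) ^ i = (\<Sum>d | d dvd i \<and> odd d. 2 * real (i div d) * of_int (q (i div d)))"
    if i: "i \<ge> 1" for i
  proof -
    have fin: "finite {e. e dvd i}" using i by (auto intro: finite_divisors_nat)
    have "int (2 * m) ^ i = (\<Sum>e | e dvd i. int e * (p e + q e))
        - (\<Sum>e | e dvd i. int e * (p e + (-1) ^ (i div e) * q e))"
      unfolding p_def q_def using necklace_counts[OF i, of "2 * m"] by simp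
    also have "\<dots> = (\<Sum>e | e dvd i. if odd (i div e) then 2 * int e * q e else 0)"
      unfolding sum_subtractf[symmetric] by (intro sum.cong) (auto simp: algebra_simps)
    also have "\<dots> = (\<Sum>d | d dvd i. if odd d then 2 * int (i div d) * q (i div d) else 0)"
      using i by (intro sum.reindex_bij_witness[of _ "\<lambda>d. i div d" "\<lambda>d. i div d"])
        (auto elim!: dvdE)
    also have "\<dots> = (\<Sum>d | d dvd i \<and> odd d. 2 * int (i div d) * q (i div d))"
      using fin by (intro sum.mono_neutral_cong_right) auto
    finally have "real_of_int (int (2 * m) ^ i)
        = real_of_int (\<Sum>d | d dvd i \<and> odd d. 2 * int (i div d) * q (i div d))" by simp
    then show ?thesis by simp
  qed
  have "(\<Sum>d | d dvd i \<and> odd d. of_int (moebius d) * (2 * real m) ^ (i div d))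
      = 2 * real i * of_int (q i)"
    by (rule odd_moebius_inversion[of "\<lambda>i. (2 * real m) ^ i"]) (use * assms in auto)
  then show ?thesis
    using assms by (simp add: shelf_exponent_def q_def)
qed

text \<open>It suffices to compare divisor sums. The vanishing signed sum expresses the divisor sum
  of \<open>int e * p e\<close> through \<open>q\<close>, with sign
  \<open>- (-1) ^ (i div e)\<close>; the doubled lengths in \<open>q'\<close> account for the sign
  change at even quotients.\<close>

lemma card_positive_necklaces:
  assumes "i \<ge> 1"
  shows "card (signed_necklaces (2 * m) i 1)
      + (if even i then card (signed_necklaces (2 * m) (i div 2) (-1)) else 0)
    = card (signed_necklaces (2 * m) i (-1))"
proof -
  define p where "p = (\<lambda>e. int (card (signed_necklaces (2 * m) e 1)))"
  define q where "q = (\<lambda>e. int (card (signed_necklaces (2 * m) e (-1))))"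
  define q' where "q' e = (if even e then q (e div 2) else 0)" for e
  have "int i * p i = int i * (q i - q' i)"
  proof (rule divisor_sum_unique[OF _ assms])
    fix i :: nat assume i: "i \<ge> 1"
    have fin: "finite {e. e dvd i}" using i by (auto intro: finite_divisors_nat)
    have "(\<Sum>e | e dvd i. int e * q' e) = (\<Sum>e | e dvd i \<and> even e. int e * q (e div 2))"
      using fin by (intro sum.mono_neutral_cong_right) (auto simp: q'_def)
    \<comment> \<open>Replace \<open>e\<close> by \<open>2 * e\<close>, which divides
      \<open>i\<close> exactly when \<open>e\<close> does so with an even quotient.\<close>
    also have "\<dots> = (\<Sum>e | e dvd i \<and> even (i div e). 2 * int e * q e)"
      using i by (intro sum.reindex_bij_witness[of _ "\<lambda>e. 2 * e" "\<lambda>e. e div 2"])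
        (auto elim!: dvdE evenE)
    also have "\<dots> = (\<Sum>e | e dvd i. if even (i div e) then 2 * int e * q e else 0)"
      using fin by (intro sum.mono_neutral_cong_left) auto
    finally have q': "(\<Sum>e | e dvd i. int e * q' e)
      = (\<Sum>e | e dvd i. if even (i div e) then 2 * int e * q e else 0)" .
    have "(\<Sum>e | e dvd i. int e * (q e - q' e))
        = (\<Sum>e | e dvd i. int e * q e - (if even (i div e) then 2 * int e * q e else 0))"
      by (simp add: right_diff_distrib sum_subtractf q')
    also have "\<dots> = (\<Sum>e | e dvd i. int e * p e - int e * (p e + (-1) ^ (i div e) * q e))"
      by (intro sum.cong) (auto simp: algebra_simps)
    also have "\<dots> = (\<Sum>e | e dvd i. int e * p e)"
      using necklace_counts(2)[OF i, of "2 * m"] by (simp add: sum_subtractf p_def q_def)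
    finally show "(\<Sum>e | e dvd i. int e * p e) = (\<Sum>e | e dvd i. int e * (q e - q' e))" by simp
  qed
  then have "p i + q' i = q i" using assms by auto
  then show ?thesis
    unfolding p_def q_def q'_def by (auto split: if_splits)
qed

subsection \<open>The deck and the words of its cards\<close>

text \<open>This is the order of the shuffled deck from top to bottom.\<close>

definition card_order :: "(nat \<Rightarrow> nat) \<Rightarrow> nat \<Rightarrow> nat \<Rightarrow> bool" where
  "card_order l c d \<longleftrightarrow> l c < l d \<or> l c = l d \<and> (if odd (l c) then c < d else d < c)"

lemma sorted_wrt_concat:
  "sorted_wrt R (concat xss) \<longleftrightarrow>
    (\<forall>xs\<in>set xss. sorted_wrt R xs) \<and> sorted_wrt (\<lambda>xs ys. \<forall>x\<in>set xs. \<forall>y\<in>set ys. R x y) xss"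
  by (induction xss) (auto simp: sorted_wrt_append)

lemma set_packet: "set (packet n l j) = {c \<in> {1..n}. l c = j}"
  by (auto simp: packet_def Let_def)

lemma sorted_packet: "sorted_wrt (card_order l) (packet n l j)"
proof -
  have "sorted_wrt (<) (filter (\<lambda>c. l c = j) [1..<Suc n])"
    by (intro sorted_wrt_filter) (simp del: upt_Suc)
  then have "sorted_wrt (\<lambda>c d. c < d \<and> l c = j \<and> l d = j) (filter (\<lambda>c. l c = j) [1..<Suc n])"
    by (rule sorted_wrt_mono_rel[rotated]) (auto simp del: upt_Suc)
  then show ?thesis
    unfolding packet_def Let_def
    by (auto simp: sorted_wrt_rev card_order_def elim!: sorted_wrt_mono_rel[rotated] simp del: upt_Suc)
qed

lemma set_shelf_deck:
  assumes "\<And>c. c \<in> {1..n} \<Longrightarrow> l c \<in> {1..2 * m}"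
  shows "set (shelf_deck m n l) = {1..n}"
  using assms by (force simp: shelf_deck_def set_packet)

lemma sorted_shelf_deck: "sorted_wrt (card_order l) (shelf_deck m n l)"
proof -
  have "sorted_wrt (\<lambda>i j. \<forall>c\<in>set (packet n l i). \<forall>d\<in>set (packet n l j). card_order l c d) [1..<Suc (2 * m)]"
    by (rule sorted_wrt_mono_rel[of _ "(<)"]) (auto simp: set_packet card_order_def simp del: upt_Suc)
  then show ?thesis
    by (simp add: shelf_deck_def sorted_wrt_concat sorted_packet sorted_wrt_map del: upt_Suc)
qed

lemma distinct_shelf_deck: "distinct (shelf_deck m n l)"
proof -
  have "\<not> card_order l c c" for c by (simp add: card_order_def)
  then show ?thesis
    using sorted_shelf_deck[of l m n]
    unfolding distinct_conv_nth sorted_wrt_iff_nth_less by (metis linorder_neqE_nat)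
qed

lemma length_shelf_deck:
  assumes "\<And>c. c \<in> {1..n} \<Longrightarrow> l c \<in> {1..2 * m}"
  shows "length (shelf_deck m n l) = n"
  using distinct_card[OF distinct_shelf_deck[of m n l]] set_shelf_deck[OF assms] by simp

lemma shelf_outcome_permutes:
  assumes "\<And>c. c \<in> {1..n} \<Longrightarrow> l c \<in> {1..2 * m}"
  shows "shelf_outcome m n l permutes {1..n}"
proof (rule bij_imp_permutes)
  have "bij_betw (\<lambda>i. shelf_deck m n l ! i) {..<n} {1..n}"
    by (rule bij_betw_nth[OF distinct_shelf_deck])
      (use length_shelf_deck[OF assms] set_shelf_deck[OF assms] in simp_all)
  moreover have "bij_betw (\<lambda>i. i - 1) {1..n} {..<n}"
    by (rule bij_betwI[where g = Suc]) auto
  ultimately have "bij_betw (\<lambda>i. shelf_deck m n l ! (i - 1)) {1..n} {1..n}"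
    using bij_betw_trans by (fastforce simp: o_def)
  moreover have "shelf_outcome m n l i = shelf_deck m n l ! (i - 1)" if "i \<in> {1..n}" for i
    using that by (simp add: shelf_outcome_def)
  ultimately show "bij_betw (shelf_outcome m n l) {1..n} {1..n}"
    using bij_betw_cong[of "{1..n}" "shelf_outcome m n l" "\<lambda>i. shelf_deck m n l ! (i - 1)"] by blast
qed (auto simp: shelf_outcome_def)

lemma shelf_outcome_order:
  assumes "\<And>c. c \<in> {1..n} \<Longrightarrow> l c \<in> {1..2 * m}"
    and "p \<in> {1..n}" "p' \<in> {1..n}" "p < p'"
  shows "card_order l (shelf_outcome m n l p) (shelf_outcome m n l p')"
proof -
  have "length (shelf_deck m n l) = n" by (rule length_shelf_deck) (rule assms(1))
  then show ?thesis
    using assms(2-4) sorted_wrt_nth_less[OF sorted_shelf_deck[of l m n], of "p - 1" "p' - 1"]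
    by (auto simp: shelf_outcome_def)
qed

section \<open>Words read along the cycles\<close>

definition orbit_word :: "('a \<Rightarrow> nat) \<Rightarrow> ('a \<Rightarrow> 'a) \<Rightarrow> 'a \<Rightarrow> nat \<Rightarrow> nat" where
  "orbit_word l w c k = l ((w ^^ k) c)"

text \<open>The word map carries \<open>w\<close> to the shift; this is what places cycles above
  necklaces.\<close>

lemma wshift_orbit_word: "wshift (orbit_word l w c) = orbit_word l w (w c)"
  by (simp add: fun_eq_iff wshift_apply orbit_word_def funpow_swap1)

lemma funpow_wshift_orbit_word: "(wshift ^^ k) (orbit_word l w c) = orbit_word l w ((w ^^ k) c)"
  by (induction k) (simp_all add: wshift_orbit_word)

text \<open>The shift drops the first letter, but a periodic word meets it again one period later.
  Words with the same shift have the same orbit, hence a common period.\<close>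

lemma wshift_inj:
  assumes "x \<in> orbit wshift x" "y \<in> orbit wshift y" "wshift x = wshift y"
  shows "x = y"
proof -
  have "orbit wshift x = orbit wshift y"
    using self_in_orbit_step[OF assms(1)] self_in_orbit_step[OF assms(2)] assms(3) by simp
  then have e: "(wshift ^^ card (orbit wshift x)) x = x" "(wshift ^^ card (orbit wshift x)) y = y"
    using card_orbit_period(1)[OF assms(1)] card_orbit_period(1)[OF assms(2)]
    by simp_all
  obtain k where "card (orbit wshift x) = Suc k"
    using gr0_implies_Suc[OF card_orbit_period(4)[OF assms(1)]] by blast
  with e show ?thesis
    using assms(3) by (simp add: funpow_swap1 del: funpow.simps) (simp add: funpow_Suc_right del: funpow.simps)
qed

text \<open>Lexicographic order, reversed after a common prefix with an odd number of even letters,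
  since each even letter stands for a packet that is turned over.\<close>

definition signed_less :: "(nat \<Rightarrow> nat) \<Rightarrow> (nat \<Rightarrow> nat) \<Rightarrow> bool" where
  "signed_less x y \<longleftrightarrow> (\<exists>k. (\<forall>i<k. x i = y i) \<and>
     (if (\<Prod>i<k. letter_sign (x i)) = 1 then x k < y k else y k < x k))"

text \<open>Either witness is the first place where the words differ, so the two witnesses coincide
  and see the same sign.\<close>

lemma signed_less_asym:
  assumes "signed_less x y" "signed_less y x"
  shows False
proof -
  from assms(1) obtain k where k: "\<forall>i<k. x i = y i"
    "if (\<Prod>i<k. letter_sign (x i)) = 1 then x k < y k else y k < x k"
    by (auto simp: signed_less_def)
  from assms(2) obtain k' where k': "\<forall>i<k'. y i = x i"
    "if (\<Prod>i<k'. letter_sign (y i)) = 1 then y k' < x k' else x k' < y k'"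
    by (auto simp: signed_less_def)
  have "x k \<noteq> y k" "x k' \<noteq> y k'" using k(2) k'(2) by (auto split: if_splits)
  then have "k = k'" using k(1) k'(1) by (metis linorder_neqE_nat)
  moreover have "(\<Prod>i<k. letter_sign (x i)) = (\<Prod>i<k. letter_sign (y i))"
    using k(1) by (intro prod.cong) auto
  ultimately show False using k(2) k'(2) by (auto split: if_splits)
qed

text \<open>A sorted listing is determined by its multiset of values: at the first disagreement both
  values would have to precede each other. This will recover the words along the positions from
  their multiplicities.\<close>

lemma eq_of_sorted_of_card_fibres_eq:
  fixes f g :: "nat \<Rightarrow> 'a"
  assumes asym: "\<And>x y. R x y \<Longrightarrow> R y x \<Longrightarrow> False"
    and f: "\<And>p p'. p \<in> {1..n} \<Longrightarrow> p' \<in> {1..n} \<Longrightarrow> p < p' \<Longrightarrow> f p \<noteq> f p' \<Longrightarrow> R (f p) (f p')"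
    and g: "\<And>p p'. p \<in> {1..n} \<Longrightarrow> p' \<in> {1..n} \<Longrightarrow> p < p' \<Longrightarrow> g p \<noteq> g p' \<Longrightarrow> R (g p) (g p')"
    and fibres: "\<And>x. card {p \<in> {1..n}. f p = x} = card {p \<in> {1..n}. g p = x}"
    and "p \<in> {1..n}"
  shows "f p = g p"
  using \<open>p \<in> {1..n}\<close>
proof (induction p rule: less_induct)
  case (less p)
  \<comment> \<open>At the first place \<open>p\<close> where \<open>f\<close> and \<open>g\<close> differ, each takes the other's value later on.\<close>
  have later: "\<exists>p'\<in>{1..n}. p < p' \<and> v p' = u p"
    if uv: "\<And>q. q < p \<Longrightarrow> q \<in> {1..n} \<Longrightarrow> u q = v q" "u p \<noteq> v p"
      "card {q \<in> {1..n}. u q = u p} = card {q \<in> {1..n}. v q = u p}" for u v :: "nat \<Rightarrow> 'a"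
  proof (rule ccontr)
    assume none: "\<not> ?thesis"
    have "{q \<in> {1..n}. v q = u p} \<subseteq> {q \<in> {1..n}. u q = u p} - {p}"
    proof (intro subsetI)
      fix q assume q: "q \<in> {q \<in> {1..n}. v q = u p}"
      have "\<not> p < q" using none q by blast
      moreover have "q \<noteq> p" using q uv(2) by auto
      ultimately have "q < p" by simp
      then show "q \<in> {q \<in> {1..n}. u q = u p} - {p}" using q uv(1) by auto
    qed
    then have "card {q \<in> {1..n}. v q = u p} \<le> card ({q \<in> {1..n}. u q = u p} - {p})"
      by (intro card_mono) auto
    also have "\<dots> < card {q \<in> {1..n}. u q = u p}"
      using less.prems by (intro card_Diff1_less) auto
    finally show False using uv(3) by simp
  qed
  show ?case
  proof (rule ccontr)
    assume neq: "f p \<noteq> g p"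
    obtain p' where p': "p' \<in> {1..n}" "p < p'" "g p' = f p"
      using later[of f g] less.IH neq fibres by blast
    obtain p'' where p'': "p'' \<in> {1..n}" "p < p''" "f p'' = g p"
      using later[of g f] less.IH neq fibres by metis
    have "R (g p) (f p)" using g[OF less.prems p'(1,2)] neq p'(3) by simp
    moreover have "R (f p) (g p)" using f[OF less.prems p''(1,2)] neq p''(3) by simp
    ultimately show False by (rule asym)
  qed
qed

section \<open>Labellings sorted along a permutation\<close>

locale sorted_labelling =
  fixes K n :: nat and l w :: "nat \<Rightarrow> nat"
  assumes permutes: "w permutes {1..n}"
    and label: "c \<in> {1..n} \<Longrightarrow> l c \<in> {1..K}"
    and order: "p \<in> {1..n} \<Longrightarrow> p' \<in> {1..n} \<Longrightarrow> p < p' \<Longrightarrow> card_order l (w p) (w p')"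
begin

abbreviation "word \<equiv> orbit_word l w"

lemma funpow_in: "c \<in> {1..n} \<Longrightarrow> (w ^^ k) c \<in> {1..n}"
  using permutes_in_image[OF permutes] by (induction k) auto

lemma funpow_inj: "(w ^^ k) c = (w ^^ k) d \<Longrightarrow> c = d"
  using permutes_inj[OF permutes] by (induction k) (auto dest: injD)

lemma self_in_orbit: "c \<in> orbit w c"
  by (rule permutation_self_in_orbit) (use permutes in \<open>auto simp: permutation_permutes\<close>)

lemma word_in: "c \<in> {1..n} \<Longrightarrow> word c k \<in> {1..K}"
  unfolding orbit_word_def by (intro label funpow_in)

lemma word_self_in_orbit: "word c \<in> orbit wshift (word c)"
proof -
  have "(w ^^ card (orbit w c)) c = c" "0 < card (orbit w c)"
    using card_orbit_period[OF self_in_orbit[of c]] by simp_all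
  then show ?thesis
    by (intro self_in_orbitI[of "card (orbit w c)"]) (simp_all add: funpow_wshift_orbit_word)
qed

lemma word_image_orbit: "word ` orbit w c = orbit wshift (word c)"
  by (rule orbit_inverse[OF self_in_orbit]) (simp add: wshift_orbit_word)

text \<open>One application of \<open>w\<close> sends positions \<open>q\<close> and
  \<open>q'\<close> to the cards found there. If these share a label they lie in one packet, so the
  order is kept or reversed according to the sign of that label, and the signs multiply along the
  word. The word starts at \<open>w p\<close>, not \<open>p\<close>, because a step from a position
  is governed by the label of the card lying there.\<close>

lemma funpow_order:
  assumes "p \<in> {1..n}" "p' \<in> {1..n}" "p \<noteq> p'" "\<And>i. i < j \<Longrightarrow> word (w p) i = word (w p') i"
  shows "(w ^^ j) p < (w ^^ j) p' \<longleftrightarrow> (p < p' \<longleftrightarrow> (\<Prod>i<j. letter_sign (word (w p) i)) = 1)"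
  using assms(4)
proof (induction j)
  case (Suc j)
  define q q' where "q = (w ^^ j) p" and "q' = (w ^^ j) p'"
  have q: "q \<in> {1..n}" "q' \<in> {1..n}" "q \<noteq> q'"
    using assms(1-3) funpow_in[of p] funpow_in[of p'] funpow_inj[of _ p p'] by (auto simp: q_def q'_def)
  have lab: "word (w p) j = l (w q)" "word (w p') j = l (w q')"
    by (simp_all add: orbit_word_def q_def q'_def funpow_swap1)
  then have eq: "l (w q) = l (w q')" using Suc.prems by (metis lessI)
  have neq: "w q \<noteq> w q'" using q(3) permutes_inj[OF permutes] by (auto dest: injD)
  have step: "w q < w q' \<longleftrightarrow> (q < q' \<longleftrightarrow> odd (l (w q)))"
    using order[OF q(1,2)] order[OF q(2,1)] eq neq q(3)
    by (cases "q < q'") (auto simp: card_order_def split: if_splits)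
  have "q < q' \<longleftrightarrow> (p < p' \<longleftrightarrow> (\<Prod>i<j. letter_sign (word (w p) i)) = 1)"
    unfolding q_def q'_def by (rule Suc.IH) (use Suc.prems in auto)
  then show ?case
    using step prod_letter_sign_cases[of "word (w p)" "{..<j}"]
    by (auto simp: lab q_def[symmetric] q'_def[symmetric] letter_sign_def)
qed (use assms(3) in auto)

text \<open>Up to the first difference, \<open>funpow_order\<close> tracks how the two positions
  compare. There the two labels differ, and they compare as the positions \<open>q\<close> and
  \<open>q'\<close> do, because packets are stacked by label.\<close>

lemma word_sorted:
  assumes "p \<in> {1..n}" "p' \<in> {1..n}" "p < p'" "word (w p) \<noteq> word (w p')"
  shows "signed_less (word (w p)) (word (w p'))"
proof -
  define k where "k = (LEAST k. word (w p) k \<noteq> word (w p') k)"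
  have k: "word (w p) k \<noteq> word (w p') k"
    unfolding k_def by (rule LeastI_ex) (use assms(4) in \<open>auto simp: fun_eq_iff\<close>)
  have less: "word (w p) i = word (w p') i" if "i < k" for i
    using not_less_Least[of i "\<lambda>k. word (w p) k \<noteq> word (w p') k"] that by (auto simp: k_def)
  define q q' where "q = (w ^^ k) p" and "q' = (w ^^ k) p'"
  have q: "q \<in> {1..n}" "q' \<in> {1..n}" "q \<noteq> q'"
    using assms(1-3) funpow_in[of p] funpow_in[of p'] funpow_inj[of _ p p'] by (auto simp: q_def q'_def)
  have lab: "word (w p) k = l (w q)" "word (w p') k = l (w q')"
    by (simp_all add: orbit_word_def q_def q'_def funpow_swap1)
  have "q < q' \<longleftrightarrow> (\<Prod>i<k. letter_sign (word (w p) i)) = 1"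
    unfolding q_def q'_def using funpow_order[of p p' k] assms less by auto
  moreover have "q < q' \<Longrightarrow> l (w q) < l (w q')" "\<not> q < q' \<Longrightarrow> l (w q') < l (w q)"
    using order[OF q(1,2)] order[OF q(2,1)] q(3) k by (auto simp: lab card_order_def)
  ultimately show ?thesis
    unfolding signed_less_def using less lab by (intro exI[of _ k]) auto
qed

text \<open>\<open>w\<close> maps the cards with word \<open>x\<close> bijectively to those with
  word \<open>wshift x\<close>; that all of these are reached rests on
  \<open>wshift_inj\<close>.\<close>

lemma card_fibre_wshift:
  assumes "x \<in> orbit wshift x"
  shows "card {c \<in> {1..n}. word c = wshift x} = card {c \<in> {1..n}. word c = x}"
proof (rule bij_betw_same_card[symmetric], rule bij_betw_imageI)
  show "inj_on w {c \<in> {1..n}. word c = x}"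
    by (rule inj_on_subset[OF permutes_inj[OF permutes]]) simp
  show "w ` {c \<in> {1..n}. word c = x} = {c \<in> {1..n}. word c = wshift x}"
  proof (intro equalityI subsetI)
    fix c assume "c \<in> w ` {c \<in> {1..n}. word c = x}"
    then obtain d where d: "d \<in> {1..n}" "word d = x" "c = w d" by blast
    then show "c \<in> {c \<in> {1..n}. word c = wshift x}"
      using permutes_in_image[OF permutes, of d] by (simp add: wshift_orbit_word[symmetric])
  next
    fix c assume c: "c \<in> {c \<in> {1..n}. word c = wshift x}"
    define d where "d = inv w c"
    have d: "c = w d" by (simp add: d_def permutes_inverses(1)[OF permutes])
    have "wshift (word d) = word c" by (simp add: wshift_orbit_word d)
    also have "\<dots> = wshift x" using c by simp
    finally have "wshift (word d) = wshift x" .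
    then have "word d = x" by (rule wshift_inj[OF word_self_in_orbit assms])
    moreover have "d \<in> {1..n}"
      using c permutes_in_image[OF permutes, of d] d by simp
    ultimately show "c \<in> w ` {c \<in> {1..n}. word c = x}"
      using d by blast
  qed
qed

lemma card_fibre_const:
  assumes "N \<in> necklaces K e" "x \<in> N" "y \<in> N"
  shows "card {c \<in> {1..n}. word c = y} = card {c \<in> {1..n}. word c = x}"
proof -
  have "card {c \<in> {1..n}. word c = (wshift ^^ k) x} = card {c \<in> {1..n}. word c = x}
      \<and> (wshift ^^ k) x \<in> N" for k
  proof (induction k)
    case (Suc k)
    then have "(wshift ^^ k) x \<in> N" by simp
    note D = necklacesD[OF assms(1) this]
    show ?case using Suc card_fibre_wshift[OF D(2)] D(3) by simp
  qed (use assms in auto)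
  moreover obtain k where "y = (wshift ^^ k) x"
    using necklacesD(1)[OF assms(1,2)] assms(3) by (auto simp: orbit_altdef)
  ultimately show ?thesis by simp
qed

text \<open>This counts cards, not copies of the necklace: a necklace of multiplicity
  \<open>r\<close> has count \<open>r * card N\<close>, see \<open>neck_count_eq\<close>.\<close>

definition neck_count :: "(nat \<Rightarrow> nat) set \<Rightarrow> nat" where
  "neck_count N = card {c \<in> {1..n}. word c \<in> N}"

lemma card_over_necklace:
  assumes "finite N"
  shows "card {c \<in> {1..n}. word c \<in> N \<and> P c} = (\<Sum>y\<in>N. card {c \<in> {1..n}. word c = y \<and> P c})"
proof -
  have "{c \<in> {1..n}. word c \<in> N \<and> P c} = (\<Union>y\<in>N. {c \<in> {1..n}. word c = y \<and> P c})"
    by auto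
  then show ?thesis using assms by (simp only:) (rule card_UN_disjoint, auto)
qed

lemma neck_count_eq:
  assumes "N \<in> necklaces K e" "x \<in> N"
  shows "neck_count N = e * card {c \<in> {1..n}. word c = x}"
proof -
  note D = necklacesD[OF assms]
  have "neck_count N = (\<Sum>y\<in>N. card {c \<in> {1..n}. word c = y})"
    using card_over_necklace[OF D(4), of "\<lambda>_. True"] by (simp add: neck_count_def)
  also have "\<dots> = (\<Sum>y\<in>N. card {c \<in> {1..n}. word c = x})"
    by (intro sum.cong refl card_fibre_const[OF assms])
  finally show ?thesis using D(5) by simp
qed

text \<open>One turn around the cycle of \<open>c\<close> returns its word to itself, so the least
  period of the word divides the cycle length, which is at most \<open>n\<close>.\<close>

lemma necklace_of_card:
  assumes "c \<in> {1..n}"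
  obtains e where "1 \<le> e" "e \<le> n" "orbit wshift (word c) \<in> necklaces K e"
    "e dvd card (orbit w c)"
proof -
  define e where "e = card (orbit wshift (word c))"
  have N: "orbit wshift (word c) \<in> necklaces K e"
    unfolding e_def using word_in[OF assms] word_self_in_orbit by (rule orbit_wshift_in_necklaces)
  have "(wshift ^^ card (orbit w c)) (word c) = word c"
    using card_orbit_period(1)[OF self_in_orbit[of c], of "card (orbit w c)"]
    by (simp add: funpow_wshift_orbit_word)
  then have dvd: "e dvd card (orbit w c)"
    using card_orbit_period(1)[OF word_self_in_orbit] by (simp add: e_def)
  have "card (orbit w c) \<le> card {1..n}"
    using permutes_orbit_subset[OF permutes assms] by (intro card_mono) auto
  moreover have "0 < card (orbit w c)"
    by (rule card_orbit_period(4)[OF self_in_orbit])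
  ultimately have "e \<le> n" "1 \<le> e" using dvd by (auto dest: dvd_imp_le intro!: Suc_leI gr0I)
  then show ?thesis using that N dvd by blast
qed

end

text \<open>The labels can be recovered from the multiset of necklaces. The counts fix how many
  cards have each word; along the positions the words are sorted by \<open>signed_less\<close>,
  hence determined place by place; and the first letter of a word is the label of its card.\<close>

lemma sorted_labelling_eqI:
  assumes "sorted_labelling K n l w" "sorted_labelling K n l' w'"
    and count: "\<And>e N. 1 \<le> e \<Longrightarrow> e \<le> n \<Longrightarrow> N \<in> necklaces K e \<Longrightarrow>
      sorted_labelling.neck_count n l w N = sorted_labelling.neck_count n l' w' N"
    and "c \<in> {1..n}"
  shows "l c = l' c"
proof -
  interpret L: sorted_labelling K n l w by fact
  interpret L': sorted_labelling K n l' w' by fact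
  have fibre: "card {c \<in> {1..n}. L.word c = x} = card {c \<in> {1..n}. L'.word c = x}" for x
  proof (cases "\<exists>e N. 1 \<le> e \<and> e \<le> n \<and> N \<in> necklaces K e \<and> x \<in> N")
    case True
    then obtain e N where N: "1 \<le> e" "e \<le> n" "N \<in> necklaces K e" "x \<in> N" by blast
    then show ?thesis
      using count[OF N(1-3)] L.neck_count_eq[OF N(3,4)] L'.neck_count_eq[OF N(3,4)] by simp
  next
    case False
    have "{c \<in> {1..n}. L.word c = x} = {}"
      using False L.necklace_of_card L.word_self_in_orbit by blast
    moreover have "{c \<in> {1..n}. L'.word c = x} = {}"
      using False L'.necklace_of_card L'.word_self_in_orbit by blast
    ultimately show ?thesis by (simp only:)
  qed
  \<comment> \<open>Listing the words by position instead of by card does not change their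
    multiplicities.\<close>
  have shifted: "card {c \<in> {1..n}. f (v c) = x} = card {c \<in> {1..n}. f c = x}"
    if v: "v permutes {1..n}" for v and f :: "nat \<Rightarrow> nat \<Rightarrow> nat" and x
  proof (rule bij_betw_same_card[of v], rule bij_betw_imageI)
    show "inj_on v {c \<in> {1..n}. f (v c) = x}"
      by (rule inj_on_subset[OF permutes_inj[OF v]]) simp
    show "v ` {c \<in> {1..n}. f (v c) = x} = {c \<in> {1..n}. f c = x}"
    proof (intro equalityI subsetI)
      fix c assume c: "c \<in> {c \<in> {1..n}. f c = x}"
      define d where "d = inv v c"
      have "c = v d" by (simp add: d_def permutes_inverses(1)[OF v])
      with c show "c \<in> v ` {c \<in> {1..n}. f (v c) = x}"
        using permutes_in_image[OF v, of d] by blast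
    next
      fix c assume "c \<in> v ` {c \<in> {1..n}. f (v c) = x}"
      then show "c \<in> {c \<in> {1..n}. f c = x}"
        using permutes_in_image[OF v] by blast
    qed
  qed
  \<comment> \<open>Now \<open>c\<close> is read as a position. The words of the cards lying there
    are the shifted words of the card \<open>c\<close>, and \<open>wshift_inj\<close> removes the
    shift.\<close>
  have "L.word (w c) = L'.word (w' c)"
  proof (rule eq_of_sorted_of_card_fibres_eq
      [of signed_less n "\<lambda>p. L.word (w p)" "\<lambda>p. L'.word (w' p)",
        OF signed_less_asym L.word_sorted L'.word_sorted _ assms(4)])
    show "card {p \<in> {1..n}. L.word (w p) = x} = card {p \<in> {1..n}. L'.word (w' p) = x}" for x
      using fibre shifted[OF L.permutes, of L.word x] shifted[OF L'.permutes, of L'.word x] by simp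
  qed
  then have "wshift (L.word c) = wshift (L'.word c)" by (simp add: wshift_orbit_word)
  then have "L.word c = L'.word c"
    by (rule wshift_inj[OF L.word_self_in_orbit L'.word_self_in_orbit])
  then show ?thesis by (simp add: orbit_word_def fun_eq_iff) (metis funpow_0)
qed

subsection \<open>Cycles above a necklace\<close>

lemma orbit_eq_of_mem: "s \<in> orbit f s \<Longrightarrow> t \<in> orbit f s \<Longrightarrow> orbit f t = orbit f s"
  using orbit_cyclic_eq3[OF cyclic_on_singleI[OF _ refl]] .

text \<open>Double counting: the orbits of size \<open>i\<close> are disjoint and cover exactly the
  points whose orbit has size \<open>i\<close>.\<close>

lemma card_orbits_of_size:
  assumes "finite A" and self: "\<And>s. s \<in> A \<Longrightarrow> s \<in> orbit f s" and sub: "\<And>s. s \<in> A \<Longrightarrow> orbit f s \<subseteq> A"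
  shows "i * card {C \<in> orbit f ` A. card C = i} = card {s \<in> A. card (orbit f s) = i}"
proof -
  have un: "\<Union> {C \<in> orbit f ` A. card C = i} = {s \<in> A. card (orbit f s) = i}"
  proof (intro equalityI subsetI)
    fix t assume "t \<in> \<Union> {C \<in> orbit f ` A. card C = i}"
    then obtain s where s: "s \<in> A" "t \<in> orbit f s" "card (orbit f s) = i" by blast
    then have "orbit f t = orbit f s" by (intro orbit_eq_of_mem self)
    then show "t \<in> {s \<in> A. card (orbit f s) = i}"
      using sub s by auto
  next
    fix t assume "t \<in> {s \<in> A. card (orbit f s) = i}"
    then show "t \<in> \<Union> {C \<in> orbit f ` A. card C = i}"
      using self[of t] by (intro UnionI[of "orbit f t"]) simp_all
  qed
  have "i * card {C \<in> orbit f ` A. card C = i} = card (\<Union> {C \<in> orbit f ` A. card C = i})"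
  proof (rule card_partition)
    show "finite {C \<in> orbit f ` A. card C = i}" using assms(1) by simp
    show "finite (\<Union> {C \<in> orbit f ` A. card C = i})" unfolding un using assms(1) by simp
    fix C D assume C: "C \<in> {C \<in> orbit f ` A. card C = i}" "D \<in> {C \<in> orbit f ` A. card C = i}" "C \<noteq> D"
    obtain s t where st: "s \<in> A" "C = orbit f s" "t \<in> A" "D = orbit f t" using C by blast
    show "C \<inter> D = {}"
    proof (rule ccontr)
      assume "C \<inter> D \<noteq> {}"
      then obtain u where u: "u \<in> orbit f s" "u \<in> orbit f t" using st by blast
      have "C = D"
        using orbit_eq_of_mem[OF self[OF st(1)] u(1)] orbit_eq_of_mem[OF self[OF st(3)] u(2)] st(2,4)
        by simp
      then show False using C(3) by simp
    qed
  qed simp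
  then show ?thesis unfolding un .
qed

text \<open>If \<open>g a < a\<close>, then \<open>g a\<close> is fixed by induction, against
  injectivity. If \<open>a < g a\<close>, the preimage of \<open>a\<close> can lie neither below
  \<open>a\<close>, where points are fixed, nor above, by monotonicity.\<close>

lemma strict_mono_inj_fixes:
  fixes g :: "nat \<Rightarrow> nat"
  assumes "finite A" "g ` A \<subseteq> A" "inj_on g A"
    and mono: "\<And>a b. a \<in> A \<Longrightarrow> b \<in> A \<Longrightarrow> a < b \<Longrightarrow> g a < g b" and "a \<in> A"
  shows "g a = a"
  using assms(5)
proof (induction a rule: less_induct)
  case (less a)
  have surj: "g ` A = A" by (rule endo_inj_surj[OF assms(1-3)])
  show ?case
  proof (cases "g a" a rule: linorder_cases)
    case less': less
    have "g a \<in> A" using assms(2) less.prems by auto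
    then have "g (g a) = g a" using less.IH less' by auto
    then show ?thesis by (rule inj_onD[OF assms(3) _ \<open>g a \<in> A\<close> less.prems])
  next
    case greater
    obtain b where b: "b \<in> A" "a = g b" using surj less.prems by (metis imageE)
    show ?thesis
    proof (cases b a rule: linorder_cases)
      case lt: less
      then have "g b = b" by (rule less.IH[OF _ b(1)])
      then show ?thesis using lt b(2) by simp
    next
      case equal
      then show ?thesis using b by simp
    next
      case greater': greater
      then have "g a < a" using mono[OF less.prems b(1)] b(2) by simp
      then show ?thesis using greater by simp
    qed
  qed simp
qed

text \<open>The points that are moved form pairs, one moved up and one moved down. Two distinct
  fixed points would contradict antitonicity.\<close>

lemma card_fixed_points_antitone_involution:
  fixes g :: "nat \<Rightarrow> nat"
  assumes "finite A" and maps: "\<And>a. a \<in> A \<Longrightarrow> g a \<in> A" and inv: "\<And>a. a \<in> A \<Longrightarrow> g (g a) = a"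
    and anti: "\<And>a b. a \<in> A \<Longrightarrow> b \<in> A \<Longrightarrow> a < b \<Longrightarrow> g b < g a"
  shows "card {a \<in> A. g a = a} = card A mod 2"
proof -
  define U V F where "U = {a \<in> A. a < g a}" and "V = {a \<in> A. g a < a}" and "F = {a \<in> A. g a = a}"
  have fin: "finite U" "finite V" "finite F" using assms(1) by (simp_all add: U_def V_def F_def)
  have "bij_betw g U V"
    by (rule bij_betwI[where g = g]) (auto simp: U_def V_def maps inv)
  then have UV: "card U = card V" by (rule bij_betw_same_card)
  have "A = U \<union> V \<union> F" by (auto simp: U_def V_def F_def)
  moreover have "U \<inter> V = {}" "(U \<union> V) \<inter> F = {}" by (auto simp: U_def V_def F_def)
  ultimately have "card A = 2 * card U + card F"
    using fin UV by (simp add: card_Un_disjoint)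
  moreover have "card F \<le> 1"
  proof (rule ccontr)
    assume "\<not> card F \<le> 1"
    then obtain a b where "a \<in> F" "b \<in> F" "a \<noteq> b"
      using fin(3) by (metis card_le_Suc0_iff_eq One_nat_def)
    then show False using anti[of a b] anti[of b a] by (auto simp: F_def neq_iff)
  qed
  ultimately show ?thesis by (simp add: F_def)
qed

text \<open>The product of \<open>X\<close> over the sizes of the cycles above \<open>N\<close> when
  each word of \<open>N\<close> belongs to \<open>r\<close> cards; see
  \<open>prod_cycles_over\<close>.\<close>

definition neck_weight :: "(nat \<Rightarrow> 'a::comm_monoid_mult) \<Rightarrow> (nat \<Rightarrow> nat) set \<Rightarrow> nat \<Rightarrow> 'a" where
  "neck_weight X N r =
    (if neck_sign N = 1 then X (card N) ^ r
     else X (card N) ^ (r mod 2) * X (2 * card N) ^ (r div 2))"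

context sorted_labelling
begin

definition cycles_over :: "(nat \<Rightarrow> nat) set \<Rightarrow> nat set set" where
  "cycles_over N = {C \<in> orbit w ` {1..n}. word ` C = N}"

lemma word_image_eq_necklace_iff:
  assumes "N \<in> necklaces K e"
  shows "word ` orbit w c = N \<longleftrightarrow> word c \<in> N"
  using necklacesD(1)[OF assms, of "word c"] word_self_in_orbit[of c] by (auto simp: word_image_orbit)

lemma card_cycles_over:
  assumes N: "N \<in> necklaces K e"
  shows "i * card {C \<in> cycles_over N. card C = i}
    = (\<Sum>y\<in>N. card {c \<in> {1..n}. word c = y \<and> card (orbit w c) = i})"
proof -
  obtain x where "x \<in> N" using necklaces_nonempty[OF N] by auto
  then have "finite N" using necklacesD[OF N] by blast
  define A where "A = {c \<in> {1..n}. word c \<in> N}"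
  have "orbit w ` A = cycles_over N"
    using word_image_eq_necklace_iff[OF N] unfolding A_def cycles_over_def by blast
  moreover have "orbit w s \<subseteq> A" if "s \<in> A" for s
  proof -
    have "word ` orbit w s = N"
      using that word_image_eq_necklace_iff[OF N] by (simp add: A_def)
    then show ?thesis
      using permutes_orbit_subset[OF permutes, of s] that by (auto simp: A_def)
  qed
  ultimately have "i * card {C \<in> cycles_over N. card C = i} = card {s \<in> A. card (orbit w s) = i}"
    using card_orbits_of_size[of A w i] self_in_orbit by (simp add: A_def)
  also have "{s \<in> A. card (orbit w s) = i} = {c \<in> {1..n}. word c \<in> N \<and> card (orbit w c) = i}"
    by (auto simp: A_def)
  finally show ?thesis by (simp only: card_over_necklace[OF \<open>finite N\<close>])
qed

text \<open>A word of \<open>N\<close> recurs after \<open>e\<close> steps, so \<open>w ^^ e\<close>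
  maps each fibre to itself. Over this full period \<open>funpow_order\<close> compares two cards by
  the sign of the whole necklace.\<close>

lemma fibre_return:
  assumes N: "N \<in> necklaces K e" and y: "y \<in> N"
  defines "A \<equiv> {c \<in> {1..n}. word c = y}"
  shows "c \<in> A \<Longrightarrow> (w ^^ e) c \<in> A"
    and "c \<in> A \<Longrightarrow> e dvd card (orbit w c)"
    and "c \<in> A \<Longrightarrow> d \<in> A \<Longrightarrow> c \<noteq> d \<Longrightarrow>
      (w ^^ e) c < (w ^^ e) d \<longleftrightarrow> (c < d \<longleftrightarrow> neck_sign N = 1)"
proof -
  note D = necklacesD[OF N y]
  have "(wshift ^^ e) y = y"
    using card_orbit_period(1)[OF D(2), of e] D(1,5) by simp
  then show "(w ^^ e) c \<in> A" if "c \<in> A"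
    using that funpow_in[of c e] funpow_wshift_orbit_word[of e l w c] by (simp add: A_def)
  show "e dvd card (orbit w c)" if "c \<in> A"
  proof -
    have "(w ^^ card (orbit w c)) c = c"
      using card_orbit_period(1)[OF self_in_orbit[of c], of "card (orbit w c)"] by simp
    then have "(wshift ^^ card (orbit w c)) y = y"
      using that funpow_wshift_orbit_word[of "card (orbit w c)" l w c] by (simp add: A_def)
    then show ?thesis
      using card_orbit_period(1)[OF D(2)] D(1,5) by simp
  qed
  assume c: "c \<in> A" and d: "d \<in> A" "c \<noteq> d"
  have "word (w c) = wshift y" "word (w d) = wshift y"
    using c d by (simp_all add: A_def wshift_orbit_word[symmetric])
  \<comment> \<open>The sign can be read from any word of the necklace; \<open>funpow_order\<close>
    starts one letter after \<open>y\<close>.\<close>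
  moreover have "neck_sign N = (\<Prod>i<e. letter_sign (wshift y i))"
    unfolding neck_sign_def by (rule prod_necklace[OF N D(3)])
  ultimately show "(w ^^ e) c < (w ^^ e) d \<longleftrightarrow> (c < d \<longleftrightarrow> neck_sign N = 1)"
    using funpow_order[of c d e] c d by (simp add: A_def)
qed

text \<open>On a fibre \<open>w ^^ e\<close> is monotone, hence the identity, so the cycle length
  divides \<open>e\<close>; conversely \<open>e\<close> divides it.\<close>

lemma card_orbit_positive:
  assumes N: "N \<in> necklaces K e" and "neck_sign N = 1" and "c \<in> {1..n}" "word c \<in> N"
  shows "card (orbit w c) = e"
proof -
  define A where "A = {d \<in> {1..n}. word d = word c}"
  note R = fibre_return[OF N assms(4), folded A_def]
  have c: "c \<in> A" using assms(3) by (simp add: A_def)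
  have "(w ^^ e) c = c"
  proof (rule strict_mono_inj_fixes[of A])
    show "inj_on (w ^^ e) A" using funpow_inj by (auto intro!: inj_onI)
    show "finite A" by (simp add: A_def)
    show "(w ^^ e) a < (w ^^ e) b" if "a \<in> A" "b \<in> A" "a < b" for a b
      using R(3)[OF that(1,2)] that(3) assms(2) by simp
  qed (use R(1) c in auto)
  then have "card (orbit w c) dvd e"
    using card_orbit_period(1)[OF self_in_orbit] by simp
  then show ?thesis using R(2)[OF c] by (rule dvd_antisym)
qed

text \<open>On a fibre \<open>w ^^ e\<close> is antitone, so its square is monotone and hence the
  identity. Its fixed points are the cards in cycles of length \<open>e\<close>, and all other
  cycles have length \<open>2 * e\<close>.\<close>

lemma card_orbit_negative:
  assumes N: "N \<in> necklaces K e" and "neck_sign N = -1" and y: "y \<in> N"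
  defines "A \<equiv> {c \<in> {1..n}. word c = y}"
  shows "card {c \<in> {1..n}. word c = y \<and> card (orbit w c) = e} = card A mod 2"
    and "c \<in> A \<Longrightarrow> card (orbit w c) = e \<or> card (orbit w c) = 2 * e"
proof -
  note D = necklacesD[OF N y]
  note R = fibre_return[OF N y, folded A_def]
  have anti: "(w ^^ e) b < (w ^^ e) a" if "a \<in> A" "b \<in> A" "a < b" for a b
    using R(3)[OF that(2,1)] that(3) assms(2) by simp
  have inv: "(w ^^ e) ((w ^^ e) c) = c" if "c \<in> A" for c
  proof (rule strict_mono_inj_fixes[of A "\<lambda>c. (w ^^ e) ((w ^^ e) c)"])
    show "inj_on (\<lambda>c. (w ^^ e) ((w ^^ e) c)) A"
      by (rule inj_onI) (metis funpow_inj)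
    show "finite A" by (simp add: A_def)
    show "(\<lambda>c. (w ^^ e) ((w ^^ e) c)) ` A \<subseteq> A" using R(1) by auto
    show "(w ^^ e) ((w ^^ e) a) < (w ^^ e) ((w ^^ e) b)" if "a \<in> A" "b \<in> A" "a < b" for a b
      using anti[OF R(1)[OF that(2)] R(1)[OF that(1)] anti[OF that]] .
  qed (use that in auto)
  have return: "(w ^^ e) c = c \<longleftrightarrow> card (orbit w c) = e" if "c \<in> A" for c
    using R(2)[OF that] card_orbit_period(1)[OF self_in_orbit, of e c]
    by (auto intro: dvd_antisym)
  have "card {c \<in> A. (w ^^ e) c = c} = card A mod 2"
    by (rule card_fixed_points_antitone_involution) (use R(1) inv anti in \<open>auto simp: A_def\<close>)
  moreover have "{c \<in> A. (w ^^ e) c = c} = {c \<in> {1..n}. word c = y \<and> card (orbit w c) = e}"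
    using return by (auto simp: A_def)
  ultimately show "card {c \<in> {1..n}. word c = y \<and> card (orbit w c) = e} = card A mod 2" by simp
  assume c: "c \<in> A"
  have "(w ^^ (e + e)) c = c" using inv[OF c] by (simp add: funpow_add)
  then have "card (orbit w c) dvd e * 2"
    using card_orbit_period(1)[OF self_in_orbit] by (simp add: mult_2_right)
  moreover obtain t where t: "card (orbit w c) = e * t" using R(2)[OF c] by blast
  ultimately have "t dvd 2" using D(6) by simp
  then have "t = 1 \<or> t = 2" using prime_nat_iff two_is_prime_nat by blast
  then show "card (orbit w c) = e \<or> card (orbit w c) = 2 * e" using t by auto
qed

lemma finite_cycles_over: "finite (cycles_over N)"
  by (simp add: cycles_over_def)

text \<open>Every fibre has \<open>r\<close> cards. Above a positive necklace all of them lie in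
  cycles of length \<open>e\<close>; above a negative one \<open>r mod 2\<close> do, and the other
  \<open>2 * (r div 2)\<close> lie in cycles of length \<open>2 * e\<close>. Summing over the
  \<open>e\<close> fibres and dividing by the cycle lengths gives the numbers of cycles.\<close>

lemma prod_cycles_over:
  assumes N: "N \<in> necklaces K e"
  shows "(\<Prod>C\<in>cycles_over N. X (card C)) = neck_weight X N (neck_count N div e)"
proof -
  obtain x where x: "x \<in> N" using necklaces_nonempty[OF N] by auto
  note D = necklacesD[OF N x]
  define r where "r = card {c \<in> {1..n}. word c = x}"
  have fibre: "card {c \<in> {1..n}. word c = y} = r" if "y \<in> N" for y
    unfolding r_def by (rule card_fibre_const[OF N x that])
  have r: "neck_count N div e = r"
    using neck_count_eq[OF N x] D(6) by (simp add: r_def)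
  have over: "\<exists>c\<in>{1..n}. C = orbit w c \<and> word c \<in> N" if "C \<in> cycles_over N" for C
    using that word_image_eq_necklace_iff[OF N] unfolding cycles_over_def by blast
  show ?thesis
  proof (cases "neck_sign N = 1")
    case True
    have size: "card C = e" if "C \<in> cycles_over N" for C
      using over[OF that] card_orbit_positive[OF N True] by blast
    have "{c \<in> {1..n}. word c = y \<and> card (orbit w c) = e} = {c \<in> {1..n}. word c = y}" if "y \<in> N" for y
      using card_orbit_positive[OF N True] that by auto
    then have "e * card {C \<in> cycles_over N. card C = e} = (\<Sum>y\<in>N. r)"
      unfolding card_cycles_over[OF N] by (intro sum.cong refl) (simp only: fibre)
    then have "card {C \<in> cycles_over N. card C = e} = r" using D(5,6) by simp
    moreover have "{C \<in> cycles_over N. card C = e} = cycles_over N" using size by auto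
    ultimately have "card (cycles_over N) = r" by simp
    then show ?thesis
      using size by (simp add: neck_weight_def True r D(5))
  next
    case False
    then have neg: "neck_sign N = -1" using neck_sign_cases by blast
    have size: "card C = e \<or> card C = 2 * e" if "C \<in> cycles_over N" for C
      using over[OF that] card_orbit_negative(2)[OF N neg] by blast
    have one: "card {c \<in> {1..n}. word c = y \<and> card (orbit w c) = e} = r mod 2" if "y \<in> N" for y
      using card_orbit_negative(1)[OF N neg that] fibre[OF that] by simp
    have two: "card {c \<in> {1..n}. word c = y \<and> card (orbit w c) = 2 * e} = 2 * (r div 2)" if y: "y \<in> N" for y
    proof -
      have "{c \<in> {1..n}. word c = y} = {c \<in> {1..n}. word c = y \<and> card (orbit w c) = e}
          \<union> {c \<in> {1..n}. word c = y \<and> card (orbit w c) = 2 * e}"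
        using card_orbit_negative(2)[OF N neg y] by blast
      moreover have "card ({c \<in> {1..n}. word c = y \<and> card (orbit w c) = e}
          \<union> {c \<in> {1..n}. word c = y \<and> card (orbit w c) = 2 * e})
        = card {c \<in> {1..n}. word c = y \<and> card (orbit w c) = e}
          + card {c \<in> {1..n}. word c = y \<and> card (orbit w c) = 2 * e}"
        using D(6) by (intro card_Un_disjoint) auto
      ultimately have "r = r mod 2 + card {c \<in> {1..n}. word c = y \<and> card (orbit w c) = 2 * e}"
        using fibre[OF y] one[OF y] by simp
      then show ?thesis by presburger
    qed
    have "e * card {C \<in> cycles_over N. card C = e} = e * (r mod 2)"
      unfolding card_cycles_over[OF N] using one D(5) by simp
    then have c1: "card {C \<in> cycles_over N. card C = e} = r mod 2" using D(6) by simp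
    have "2 * e * card {C \<in> cycles_over N. card C = 2 * e} = e * (2 * (r div 2))"
      unfolding card_cycles_over[OF N] using two D(5) by simp
    then have c2: "card {C \<in> cycles_over N. card C = 2 * e} = r div 2" using D(6) by simp
    have split: "cycles_over N = {C \<in> cycles_over N. card C = e} \<union> {C \<in> cycles_over N. card C = 2 * e}"
      using size by blast
    have "(\<Prod>C\<in>cycles_over N. X (card C))
        = (\<Prod>C | C \<in> cycles_over N \<and> card C = e. X (card C)) * (\<Prod>C | C \<in> cycles_over N \<and> card C = 2 * e. X (card C))"
      by (subst split, rule prod.union_disjoint) (use D(6) finite_cycles_over in auto)
    also have "\<dots> = X e ^ (r mod 2) * X (2 * e) ^ (r div 2)"
      using c1 c2 by simp
    finally show ?thesis by (simp add: neck_weight_def False r D(5))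
  qed
qed

text \<open>Group the cycles once by size and once by the necklace below them. Every necklace that
  occurs has length at most \<open>n\<close>, so any bound \<open>M \<ge> n\<close> serves.\<close>

lemma prod_num_cycles:
  assumes "n \<le> M"
  shows "(\<Prod>i=1..n. X i ^ num_cycles n w i)
    = (\<Prod>N\<in>(\<Union>e\<in>{1..M}. necklaces K e). neck_weight X N (neck_count N div card N))"
proof -
  define cycles where "cycles = orbit w ` {1..n}"
  have fin: "finite cycles" by (simp add: cycles_def)
  have card: "card C \<in> {1..n}" if C: "C \<in> cycles" for C
  proof -
    obtain c where c: "c \<in> {1..n}" "C = orbit w c" using C by (auto simp: cycles_def)
    have "card (orbit w c) \<le> card {1..n}"
      using permutes_orbit_subset[OF permutes c(1)] by (intro card_mono) auto
    moreover have "0 < card (orbit w c)"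
      by (rule card_orbit_period(4)[OF self_in_orbit])
    ultimately show ?thesis by (simp add: c(2))
  qed
  have num: "num_cycles n w i = card {C \<in> cycles. card C = i}" for i
    unfolding num_cycles_def cycles_def by (rule arg_cong[where f = card]) auto
  have "(\<Prod>i=1..n. X i ^ num_cycles n w i) = (\<Prod>i=1..n. \<Prod>C | C \<in> cycles \<and> card C = i. X (card C))"
    by (simp add: num)
  also have "\<dots> = (\<Prod>C\<in>cycles. X (card C))"
    by (rule prod.group) (use fin card in auto)
  also have "\<dots> = (\<Prod>N\<in>(\<Union>e\<in>{1..M}. necklaces K e). \<Prod>C | C \<in> cycles \<and> word ` C = N. X (card C))"
  proof (rule prod.group[symmetric])
    show "(`) word ` cycles \<subseteq> (\<Union>e\<in>{1..M}. necklaces K e)"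
    proof
      fix N assume "N \<in> (`) word ` cycles"
      then obtain c where c: "c \<in> {1..n}" "N = orbit wshift (word c)"
        by (auto simp: cycles_def word_image_orbit)
      show "N \<in> (\<Union>e\<in>{1..M}. necklaces K e)"
        using necklace_of_card[OF c(1)] assms c(2) by (metis UN_I atLeastAtMost_iff le_trans)
    qed
  qed (use fin finite_necklaces in auto)
  also have "\<dots> = (\<Prod>N\<in>(\<Union>e\<in>{1..M}. necklaces K e). neck_weight X N (neck_count N div card N))"
  proof (rule prod.cong[OF refl])
    fix N assume "N \<in> (\<Union>e\<in>{1..M}. necklaces K e)"
    then obtain e where N: "N \<in> necklaces K e" by blast
    show "(\<Prod>C | C \<in> cycles \<and> word ` C = N. X (card C)) = neck_weight X N (neck_count N div card N)"
      using prod_cycles_over[OF N] by (simp add: cycles_over_def cycles_def necklaces_eq_size[OF N])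
  qed
  finally show ?thesis .
qed

end

subsection \<open>Counting multisets of necklaces\<close>

definition compositions_on :: "'a set \<Rightarrow> nat \<Rightarrow> ('a \<Rightarrow> nat) set" where
  "compositions_on W n = {d. (\<forall>x. x \<notin> W \<longrightarrow> d x = 0) \<and> sum d W = n}"

lemma finite_compositions_on:
  assumes "finite W"
  shows "finite (compositions_on W n)"
proof (rule finite_subset)
  show "compositions_on W n \<subseteq> {d. \<forall>x. (x \<in> W \<longrightarrow> d x \<in> {..n}) \<and> (x \<notin> W \<longrightarrow> d x = 0)}"
    using assms by (auto simp: compositions_on_def intro: member_le_sum)
  show "finite {d. \<forall>x. (x \<in> W \<longrightarrow> d x \<in> {..n}) \<and> (x \<notin> W \<longrightarrow> d x = 0)}"
    by (rule finite_set_of_finite_funs) (use assms in auto)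
qed

text \<open>The iterated Cauchy product: the value at the new index is split off, and resetting it
  to 0 leaves a composition on the old set.\<close>

lemma fps_prod_nth_compositions:
  fixes F :: "'b \<Rightarrow> 'a::comm_semiring_1 fps"
  assumes "finite W"
  shows "fps_nth (\<Prod>x\<in>W. F x) n = (\<Sum>d\<in>compositions_on W n. \<Prod>x\<in>W. fps_nth (F x) (d x))"
  using assms
proof (induction W arbitrary: n)
  case empty
  have "compositions_on ({} :: 'b set) n = (if n = 0 then {\<lambda>_. 0} else {})"
    by (auto simp: compositions_on_def)
  then show ?case by simp
next
  case (insert a W)
  let ?P = "\<lambda>d. \<Prod>x\<in>W. fps_nth (F x) (d x)"
  have "fps_nth (\<Prod>x\<in>insert a W. F x) n
      = (\<Sum>i=0..n. fps_nth (F a) i * (\<Sum>d\<in>compositions_on W (n - i). ?P d))"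
    using insert by (simp add: fps_mult_nth)
  also have "\<dots> = (\<Sum>(i, d)\<in>(SIGMA i:{0..n}. compositions_on W (n - i)). fps_nth (F a) i * ?P d)"
    using finite_compositions_on[OF insert.hyps(1)]
    by (simp add: sum_distrib_left sum.Sigma)
  also have "\<dots> = (\<Sum>d\<in>compositions_on (insert a W) n. \<Prod>x\<in>insert a W. fps_nth (F x) (d x))"
  proof (rule sum.reindex_bij_witness[of _ "\<lambda>d. (d a, d(a := 0))" "\<lambda>(i, d). d(a := i)"])
    fix u assume "u \<in> (SIGMA i:{0..n}. compositions_on W (n - i))"
    then obtain i d where u: "u = (i, d)" "i \<le> n" "d \<in> compositions_on W (n - i)" by auto
    have "d a = 0" using u(3) insert.hyps(2) by (simp add: compositions_on_def)
    then show "((case u of (i, d) \<Rightarrow> d(a := i)) a, (case u of (i, d) \<Rightarrow> d(a := i))(a := 0)) = u"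
      by (simp add: u(1) fun_upd_idem)
    have W: "sum (d(a := i)) W = sum d W" "?P (d(a := i)) = ?P d"
      using insert.hyps(2) by (auto intro!: sum.cong prod.cong)
    show "(case u of (i, d) \<Rightarrow> d(a := i)) \<in> compositions_on (insert a W) n"
      using u W insert.hyps by (simp add: compositions_on_def)
    show "(\<Prod>x\<in>insert a W. fps_nth (F x) ((case u of (i, d) \<Rightarrow> d(a := i)) x))
        = (case u of (i, d) \<Rightarrow> fps_nth (F a) i * ?P d)"
      using u W(2) insert.hyps by simp
  next
    fix d assume d: "d \<in> compositions_on (insert a W) n"
    show "(case (d a, d(a := 0)) of (i, d) \<Rightarrow> d(a := i)) = d" by simp
    have "sum (d(a := 0)) W = sum d W"
      using insert.hyps(2) by (auto intro!: sum.cong)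
    then show "(d a, d(a := 0)) \<in> (SIGMA i:{0..n}. compositions_on W (n - i))"
      using d insert.hyps by (auto simp: compositions_on_def)
  qed
  finally show ?case .
qed

section \<open>Geometric series and logarithmic derivatives\<close>

definition fps_geometric :: "nat \<Rightarrow> 'a::comm_ring_1 fps" where
  "fps_geometric e = Abs_fps (\<lambda>d. if e dvd d then 1 else 0)"

lemma fps_geometric_mult:
  assumes "e \<ge> 1"
  shows "(1 - fps_X ^ e) * fps_geometric e = 1"
proof (rule fps_ext)
  fix d
  have "e dvd d \<longleftrightarrow> e dvd (d - e)" if "e \<le> d" using that by (auto simp: dvd_minus_self)
  moreover have "\<not> e dvd d" if "d < e" "d > 0" using that by (auto dest: dvd_imp_le)
  ultimately show "fps_nth ((1 - fps_X ^ e) * fps_geometric e) d = fps_nth 1 d"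
    using assms by (auto simp: left_diff_distrib fps_geometric_def fps_X_power_mult_nth not_less)
qed

text \<open>Differentiating \<open>fps_geometric_mult\<close> gives the logarithmic derivative
  \<open>e * X^e / (1 - X^e)\<close>, stated without division.\<close>

lemma fps_deriv_geometric:
  assumes "e \<ge> 1"
  shows "fps_X * fps_deriv (fps_geometric e :: 'a::comm_ring_1 fps)
    = fps_geometric e * (of_nat e * fps_X ^ e * fps_geometric e)"
proof -
  let ?G = "fps_geometric e :: 'a fps"
  have XX: "fps_X * fps_X ^ (e - 1) = (fps_X ^ e :: 'a fps)"
    using assms by (simp add: power_eq_if)
  have "fps_deriv ((1 - fps_X ^ e) * ?G) = 0"
    by (simp add: fps_geometric_mult[OF assms])
  then have "(1 - fps_X ^ e) * fps_deriv ?G = of_nat e * fps_X ^ (e - 1) * ?G"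
    by (simp add: fps_deriv_power' algebra_simps)
  then have "?G * (fps_X * ((1 - fps_X ^ e) * fps_deriv ?G))
      = ?G * (fps_X * (of_nat e * fps_X ^ (e - 1) * ?G))" by simp
  also have "\<dots> = ?G * (of_nat e * fps_X ^ e * ?G)"
    by (simp add: XX[symmetric] mult_ac)
  also have "?G * (fps_X * ((1 - fps_X ^ e) * fps_deriv ?G))
      = ((1 - fps_X ^ e) * ?G) * (fps_X * fps_deriv ?G)" by (simp only: mult_ac)
  finally show ?thesis by (simp add: fps_geometric_mult[OF assms])
qed

text \<open>Logarithmic derivatives add up over a product.\<close>

lemma fps_X_deriv_prod:
  fixes F :: "'b \<Rightarrow> 'a::comm_ring_1 fps"
  assumes "finite W" "\<And>x. x \<in> W \<Longrightarrow> fps_X * fps_deriv (F x) = F x * B x"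
  shows "fps_X * fps_deriv (\<Prod>x\<in>W. F x) = (\<Prod>x\<in>W. F x) * (\<Sum>x\<in>W. B x)"
  using assms
proof (induction W)
  case (insert a W)
  have "fps_X * fps_deriv (\<Prod>x\<in>insert a W. F x)
      = F a * (fps_X * fps_deriv (\<Prod>x\<in>W. F x)) + (fps_X * fps_deriv (F a)) * (\<Prod>x\<in>W. F x)"
    using insert.hyps by (simp add: algebra_simps)
  also have "\<dots> = F a * ((\<Prod>x\<in>W. F x) * (\<Sum>x\<in>W. B x)) + F a * B a * (\<Prod>x\<in>W. F x)"
    using insert by simp
  finally show ?case using insert.hyps by (simp add: algebra_simps)
qed simp

definition necklaces_upto :: "nat \<Rightarrow> nat \<Rightarrow> (nat \<Rightarrow> nat) set set" where
  "necklaces_upto K M = (\<Union>e\<in>{1..M}. necklaces K e)"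

lemma finite_necklaces_upto: "finite (necklaces_upto K M)"
  by (simp add: necklaces_upto_def finite_necklaces)

lemma sum_necklaces_upto:
  fixes F :: "_ \<Rightarrow> 'a::comm_monoid_add"
  shows "(\<Sum>N\<in>necklaces_upto K M. F N) = (\<Sum>e=1..M. \<Sum>N\<in>necklaces K e. F N)"
  unfolding necklaces_upto_def
  by (rule sum.UNION_disjoint) (auto simp: finite_necklaces dest: necklaces_eq_size)

lemma prod_necklaces_upto:
  fixes F :: "_ \<Rightarrow> 'a::comm_monoid_mult"
  shows "(\<Prod>N\<in>necklaces_upto K M. F N) = (\<Prod>e=1..M. \<Prod>N\<in>necklaces K e. F N)"
  unfolding necklaces_upto_def
  by (rule prod.UNION_disjoint) (auto simp: finite_necklaces dest: necklaces_eq_size)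

text \<open>The coefficient counts multisets of necklaces of total length \<open>n\<close>. For
  \<open>1 \<le> k \<le> M\<close> the logarithmic derivative has coefficient \<open>K ^ k\<close>
  by \<open>sum_necklaces\<close>, since all divisors of \<open>k\<close> are at most
  \<open>M\<close>. So \<open>n\<close> times the \<open>n\<close>-th coefficient is a sum of
  \<open>n\<close> terms, each equal to \<open>K ^ n\<close> by induction.\<close>

lemma fps_nth_prod_geometric_necklaces:
  assumes "n \<le> M"
  shows "fps_nth (\<Prod>N\<in>necklaces_upto K M. fps_geometric (card N) :: int fps) n = int K ^ n"
  using assms
proof (induction n rule: less_induct)
  case (less n)
  define G where "G = (\<Prod>N\<in>necklaces_upto K M. fps_geometric (card N) :: int fps)"
  define B where "B N = of_nat (card N) * fps_X ^ card N * (fps_geometric (card N) :: int fps)"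
    for N :: "(nat \<Rightarrow> nat) set"
  have pos: "card N \<ge> 1" if "N \<in> necklaces_upto K M" for N
    using that by (auto simp: necklaces_upto_def necklaces_def)
  have deriv: "fps_X * fps_deriv G = G * (\<Sum>N\<in>necklaces_upto K M. B N)"
    unfolding G_def B_def
    by (rule fps_X_deriv_prod[OF finite_necklaces_upto fps_deriv_geometric[OF pos]])
  have Bnth: "fps_nth (B N) k = (if 0 < k \<and> card N dvd k then int (card N) else 0)"
    if "N \<in> necklaces_upto K M" for N k
  proof -
    have "card N dvd k \<longleftrightarrow> card N dvd (k - card N)" if "card N \<le> k"
      using that by (auto simp: dvd_minus_self)
    moreover have "\<not> card N dvd k" if "k < card N" "k > 0"
      using that by (auto dest: dvd_imp_le)
    ultimately show ?thesis
      using pos[OF that]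
      by (auto simp: B_def fps_of_nat[symmetric] mult.assoc fps_X_power_mult_nth fps_geometric_def not_less)
  qed
  have Bsum: "fps_nth (\<Sum>N\<in>necklaces_upto K M. B N) k = int K ^ k" if "1 \<le> k" "k \<le> M" for k
  proof -
    have "fps_nth (\<Sum>N\<in>necklaces_upto K M. B N) k
        = (\<Sum>N\<in>necklaces_upto K M. if card N dvd k then int (card N) else 0)"
      using that(1) by (simp add: fps_sum_nth Bnth)
    also have "\<dots> = (\<Sum>e=1..M. \<Sum>N\<in>necklaces K e. if e dvd k then int e else 0)"
      unfolding sum_necklaces_upto by (intro sum.cong refl) (simp add: necklaces_eq_size)
    also have "\<dots> = (\<Sum>e | e dvd k. \<Sum>N\<in>necklaces K e. int e)"
    proof (rule sum.mono_neutral_cong_right)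
      show "{e. e dvd k} \<subseteq> {1..M}"
      proof
        fix e assume "e \<in> {e. e dvd k}"
        then have "e dvd k" by simp
        then show "e \<in> {1..M}"
          using that dvd_imp_le[of e k] dvd_pos_nat[of k e] by simp
      qed
    qed auto
    also have "\<dots> = int K ^ k"
      using sum_necklaces[OF that(1), of "\<lambda>_. 1 :: int" K] by simp
    finally show ?thesis .
  qed
  have "fps_nth (B N) 0 = 0" if "N \<in> necklaces_upto K M" for N using Bnth[OF that, of 0] by simp
  then have B0: "fps_nth (\<Sum>N\<in>necklaces_upto K M. B N) 0 = 0" by (simp add: fps_sum_nth)
  show ?case
  proof (cases n)
    case 0
    have "fps_nth G 0 = (\<Prod>N\<in>necklaces_upto K M. fps_nth (fps_geometric (card N)) 0)"
      unfolding G_def by (induction rule: infinite_finite_induct[of _ "necklaces_upto K M"]) auto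
    then show ?thesis by (simp add: 0 G_def fps_geometric_def)
  next
    case (Suc n')
    have "int n * fps_nth G n = fps_nth (fps_X * fps_deriv G) n"
      by (simp add: Suc algebra_simps)
    also have "\<dots> = (\<Sum>i=0..n. fps_nth G i * fps_nth (\<Sum>N\<in>necklaces_upto K M. B N) (n - i))"
      unfolding deriv by (rule fps_mult_nth)
    \<comment> \<open>The term \<open>i = n\<close> vanishes by \<open>B0\<close>, which leaves only
      coefficients covered by the induction hypothesis.\<close>
    also have "\<dots> = (\<Sum>i=0..<n. fps_nth G i * fps_nth (\<Sum>N\<in>necklaces_upto K M. B N) (n - i))"
      by (simp add: atLeast0_atMost_Suc[symmetric] Suc B0 sum.atLeast0_atMost_Suc atLeast0LessThan lessThan_Suc_atMost atMost_atLeast0)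
    also have "\<dots> = (\<Sum>i=0..<n. int K ^ n)"
    proof (intro sum.cong refl)
      fix i assume i: "i \<in> {0..<n}"
      have "fps_nth G i = int K ^ i" unfolding G_def using i less by auto
      moreover have "fps_nth (\<Sum>N\<in>necklaces_upto K M. B N) (n - i) = int K ^ (n - i)"
        using i less.prems by (intro Bsum) auto
      ultimately show "fps_nth G i * fps_nth (\<Sum>N\<in>necklaces_upto K M. B N) (n - i) = int K ^ n"
        using i by (simp add: power_add[symmetric])
    qed
    finally show ?thesis using Suc by (simp add: G_def)
  qed
qed

text \<open>Such a \<open>d\<close> encodes a multiset of necklaces, \<open>d N\<close> being the
  total length of the copies of \<open>N\<close>. The coefficients of the geometric series are the
  indicators of divisibility.\<close>

lemma card_divisible_compositions:
  assumes "n \<le> M"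
  shows "card {d \<in> compositions_on (necklaces_upto K M) n. \<forall>N\<in>necklaces_upto K M. card N dvd d N} = K ^ n"
proof -
  let ?W = "necklaces_upto K M"
  have "int K ^ n = (\<Sum>d\<in>compositions_on ?W n. \<Prod>N\<in>?W. fps_nth (fps_geometric (card N)) (d N))"
    using fps_nth_prod_geometric_necklaces[OF assms, of K]
    by (simp add: fps_prod_nth_compositions finite_necklaces_upto)
  also have "\<dots> = (\<Sum>d\<in>compositions_on ?W n. if \<forall>N\<in>?W. card N dvd d N then 1 else 0)"
    by (intro sum.cong refl) (auto simp: fps_geometric_def finite_necklaces_upto intro!: prod.neutral)
  also have "\<dots> = (\<Sum>d\<in>{d \<in> compositions_on ?W n. \<forall>N\<in>?W. card N dvd d N}. 1)"
    by (rule sum.inter_filter[symmetric]) (simp add: finite_compositions_on finite_necklaces_upto)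
  finally show ?thesis by (simp flip: of_nat_power)
qed

subsection \<open>Generating functions\<close>

lemma xconst_mult: "xconst a * xconst b = xconst (a * b)"
  by (simp add: xconst_def mult_single)

lemma xconst_1 [simp]: "xconst 1 = 1"
  by (simp add: xconst_def)

lemma xconst_power: "xconst a ^ k = xconst (a ^ k)"
  by (induction k) (simp_all add: xconst_mult)

lemma xconst_sum: "xconst (\<Sum>x\<in>A. f x) = (\<Sum>x\<in>A. xconst (f x))"
  by (induction A rule: infinite_finite_induct) (simp_all add: xconst_def single_add)

abbreviation (input) scale :: "nat \<Rightarrow> xpoly" where
  "scale m \<equiv> xconst (1 / (2 * real m))"

lemma cycle_term_eq: "cycle_term m i = fps_const (xvar i * scale m ^ i) * fps_X ^ i"
  by (simp add: cycle_term_def power_mult_distrib mult.assoc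
      flip: fps_const_mult)

lemma cycle_term_mult_nth:
  "fps_nth (cycle_term m i * f) d = (if d < i then 0 else xvar i * scale m ^ i * fps_nth f (d - i))"
  by (simp add: cycle_term_eq mult.assoc fps_X_power_mult_nth)

lemma cycle_term_nth: "fps_nth (cycle_term m i) d = (if d = i then xvar i * scale m ^ i else 0)"
  by (simp add: cycle_term_eq)

definition cycle_series :: "nat \<Rightarrow> nat \<Rightarrow> xpoly fps" where
  "cycle_series m i = fps_recip (1 - cycle_term m i)"

lemma cycle_series_eqI:
  assumes "i \<ge> 1" and "(1 - cycle_term m i) * b = 1 + a"
  shows "b = (1 + a) * cycle_series m i"
proof -
  have "fps_nth (1 - cycle_term m i) 0 = 1" using assms(1) by (simp add: cycle_term_nth)
  note inv = fps_mult_recip[OF this]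
  have "b = ((1 - cycle_term m i) * fps_recip (1 - cycle_term m i)) * b" by (simp only: inv mult_1)
  also have "\<dots> = ((1 - cycle_term m i) * b) * cycle_series m i"
    by (simp only: cycle_series_def mult_ac)
  finally show ?thesis by (simp only: assms(2))
qed

lemma cycle_series_mult: "i \<ge> 1 \<Longrightarrow> (1 - cycle_term m i) * cycle_series m i = 1"
  unfolding cycle_series_def by (rule fps_mult_recip) (simp add: cycle_term_nth)

lemma cycle_series_nth_less:
  assumes "d < i"
  shows "fps_nth (cycle_series m i) d = (if d = 0 then 1 else 0)"
proof -
  have "fps_nth ((1 - cycle_term m i) * cycle_series m i) d = fps_nth (cycle_series m i) d"
    using assms by (simp add: left_diff_distrib cycle_term_mult_nth)
  then show ?thesis using cycle_series_mult[of i m] assms by simp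
qed

text \<open>Degree \<open>d\<close> stands for \<open>d div card N\<close> copies of
  \<open>N\<close>, with a factor \<open>1 / (2 * m)\<close> for each card.\<close>

definition necklace_series :: "nat \<Rightarrow> (nat \<Rightarrow> nat) set \<Rightarrow> xpoly fps" where
  "necklace_series m N = Abs_fps (\<lambda>d. if card N dvd d
     then neck_weight xvar N (d div card N) * scale m ^ d else 0)"

lemma necklace_series_positive:
  assumes "neck_sign N = 1" "card N \<ge> 1"
  shows "necklace_series m N = cycle_series m (card N)"
proof -
  have "(1 - cycle_term m (card N)) * necklace_series m N = 1 + 0"
  proof (rule fps_ext)
    fix d
    let ?e = "card N"
    show "fps_nth ((1 - cycle_term m ?e) * necklace_series m N) d = fps_nth (1 + 0) d"
    proof (cases "d < ?e")
      case True
      then show ?thesis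
        using assms(2) by (auto simp: left_diff_distrib cycle_term_mult_nth necklace_series_def
          neck_weight_def assms(1) dest: dvd_imp_le)
    next
      case False
      then obtain d' where d: "d = d' + ?e" by (metis add.commute le_Suc_ex not_less)
      then show ?thesis
        using assms(2) by (simp add: left_diff_distrib cycle_term_mult_nth necklace_series_def
          neck_weight_def assms(1) power_add mult_ac)
    qed
  qed
  from cycle_series_eqI[OF assms(2) this] show ?thesis by simp
qed

text \<open>Two further copies of a negative necklace bring one more cycle of length
  \<open>2 * card N\<close>. Multiplying by \<open>1 - cycle_term m (2 * card N)\<close> therefore
  cancels all terms except those for 0 and 1 copies.\<close>

lemma necklace_series_negative:
  assumes "neck_sign N = -1" "card N \<ge> 1"
  shows "necklace_series m N = (1 + cycle_term m (card N)) * cycle_series m (2 * card N)"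
proof (rule cycle_series_eqI)
  let ?e = "card N"
  show "(1 - cycle_term m (2 * ?e)) * necklace_series m N = 1 + cycle_term m ?e"
  proof (rule fps_ext)
    fix d
    show "fps_nth ((1 - cycle_term m (2 * ?e)) * necklace_series m N) d = fps_nth (1 + cycle_term m ?e) d"
    proof (cases "d < 2 * ?e")
      case True
      have "d = 0 \<or> d = ?e" if e: "?e dvd d"
      proof -
        obtain t where t: "d = ?e * t" using e by blast
        then have "t < 2" using True by simp
        then show ?thesis using t by (cases "t = 0") (auto simp: less_2_cases_iff)
      qed
      then show ?thesis
        using True assms(2) by (auto simp: left_diff_distrib cycle_term_mult_nth cycle_term_nth
          necklace_series_def neck_weight_def assms(1))
    next
      case False
      then obtain d' where d: "d = d' + 2 * ?e" by (metis add.commute le_Suc_ex not_less)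
      have "?e dvd d \<longleftrightarrow> ?e dvd d'" by (simp add: d)
      moreover have "d div ?e = d' div ?e + 2" using assms(2) by (simp add: d)
      ultimately show ?thesis
        using assms(2) d by (simp add: left_diff_distrib cycle_term_mult_nth cycle_term_nth
          necklace_series_def neck_weight_def assms(1) power_add mult_ac)
    qed
  qed
qed (use assms(2) in simp)

lemma fps_mult_nth_trivial:
  fixes f g :: "'a::comm_ring_1 fps"
  assumes "\<And>k. k \<le> M \<Longrightarrow> fps_nth g k = (if k = 0 then 1 else 0)" "n \<le> M"
  shows "fps_nth (f * g) n = fps_nth f n"
proof -
  have "fps_nth (f * g) n = (\<Sum>i=0..n. if i = n then fps_nth f i else 0)"
    unfolding fps_mult_nth using assms by (intro sum.cong) auto
  then show ?thesis by simp
qed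

lemma fps_prod_nth_trivial:
  fixes g :: "'b \<Rightarrow> 'a::comm_ring_1 fps"
  assumes "\<And>x k. x \<in> A \<Longrightarrow> k \<le> M \<Longrightarrow> fps_nth (g x) k = (if k = 0 then 1 else 0)" "k \<le> M"
  shows "fps_nth (\<Prod>x\<in>A. g x) k = (if k = 0 then 1 else 0)"
  using assms
proof (induction A arbitrary: k rule: infinite_finite_induct)
  case (insert a A)
  then show ?case
    by (simp add: mult.commute[of "g a"] fps_mult_nth_trivial[of M "g a"])
qed auto

lemma fps_nth_prod_0:
  fixes g :: "'b \<Rightarrow> 'a::comm_ring_1 fps"
  shows "fps_nth (\<Prod>x\<in>A. g x) 0 = (\<Prod>x\<in>A. fps_nth (g x) 0)"
  by (induction A rule: infinite_finite_induct) auto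

text \<open>The necklaces of length \<open>e\<close> contribute
  \<open>?G e ^ p e * ((1 + ?T e) * ?G (2 * e)) ^ ?q e\<close>. Collecting the factors
  \<open>?G (2 * e)\<close> at their own index adds \<open>?q (e div 2)\<close> to the exponent
  \<open>p e\<close> for even \<open>e\<close>, and by \<open>card_positive_necklaces\<close> the
  total is \<open>?q e\<close>.\<close>

lemma prod_necklace_series:
  defines "q \<equiv> \<lambda>m e. card (signed_necklaces (2 * m) e (-1))"
  assumes "n \<le> M"
  shows "fps_nth (\<Prod>N\<in>necklaces_upto (2 * m) M. necklace_series m N) n
    = fps_nth (\<Prod>e=1..M. ((1 + cycle_term m e) * cycle_series m e) ^ q m e) n"
proof -
  let ?T = "cycle_term m" and ?G = "cycle_series m" and ?q = "q m"
  define p where "p e = card (signed_necklaces (2 * m) e 1)" for e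
  have neck: "(\<Prod>N\<in>necklaces (2 * m) e. necklace_series m N)
      = ?G e ^ p e * ((1 + ?T e) * ?G (2 * e)) ^ ?q e" if e: "e \<ge> 1" for e
  proof -
    have "necklaces (2 * m) e = signed_necklaces (2 * m) e 1 \<union> signed_necklaces (2 * m) e (-1)"
      using neck_sign_cases by (auto simp: signed_necklaces_def)
    moreover have "signed_necklaces (2 * m) e 1 \<inter> signed_necklaces (2 * m) e (-1) = {}"
      by (auto simp: signed_necklaces_def)
    moreover have "finite (signed_necklaces (2 * m) e s)" for s
      by (simp add: signed_necklaces_def finite_necklaces)
    ultimately have "(\<Prod>N\<in>necklaces (2 * m) e. necklace_series m N)
        = (\<Prod>N\<in>signed_necklaces (2 * m) e 1. necklace_series m N)
          * (\<Prod>N\<in>signed_necklaces (2 * m) e (-1). necklace_series m N)"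
      by (simp add: prod.union_disjoint)
    also have "(\<Prod>N\<in>signed_necklaces (2 * m) e 1. necklace_series m N)
        = (\<Prod>N\<in>signed_necklaces (2 * m) e 1. ?G e)"
      using e by (intro prod.cong refl)
        (auto simp: signed_necklaces_def necklaces_eq_size necklace_series_positive)
    also have "(\<Prod>N\<in>signed_necklaces (2 * m) e (-1). necklace_series m N)
        = (\<Prod>N\<in>signed_necklaces (2 * m) e (-1). (1 + ?T e) * ?G (2 * e))"
      using e by (intro prod.cong refl)
        (auto simp: signed_necklaces_def necklaces_eq_size necklace_series_negative)
    finally show ?thesis by (simp add: p_def q_def)
  qed
  have neck_prod: "(\<Prod>N\<in>necklaces_upto (2 * m) M. necklace_series m N)
      = (\<Prod>e=1..M. ?G e ^ p e * ((1 + ?T e) * ?G (2 * e)) ^ ?q e)"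
    unfolding prod_necklaces_upto by (intro prod.cong refl neck) simp
  \<comment> \<open>the factors that the negative necklaces contribute in degrees above \<open>M\<close>\<close>
  define E where "E = (\<Prod>j\<in>{M div 2<..M}. ?G (2 * j) ^ ?q j)"
  have "(\<Prod>e=1..M. ?G e ^ (if even e then ?q (e div 2) else 0))
      = (\<Prod>j=1..M div 2. ?G (2 * j) ^ ?q j)"
  proof -
    have "(\<Prod>e=1..M. ?G e ^ (if even e then ?q (e div 2) else 0))
        = (\<Prod>e\<in>(\<lambda>j. 2 * j) ` {1..M div 2}. ?G e ^ (if even e then ?q (e div 2) else 0))"
      by (rule prod.mono_neutral_right) (auto simp: image_iff elim!: evenE)
    also have "\<dots> = (\<Prod>j=1..M div 2. ?G (2 * j) ^ ?q j)"
      by (subst prod.reindex) (auto intro: inj_onI)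
    finally show ?thesis .
  qed
  then have "(\<Prod>e=1..M. ?G (2 * e) ^ ?q e)
      = (\<Prod>e=1..M. ?G e ^ (if even e then ?q (e div 2) else 0)) * E"
    unfolding E_def by (simp, subst prod.union_disjoint[symmetric]) (auto intro!: prod.cong)
  then have "(\<Prod>N\<in>necklaces_upto (2 * m) M. necklace_series m N)
      = (\<Prod>e=1..M. ?G e ^ p e * (1 + ?T e) ^ ?q e)
        * (\<Prod>e=1..M. ?G e ^ (if even e then ?q (e div 2) else 0)) * E"
    unfolding neck_prod by (simp add: power_mult_distrib prod.distrib mult_ac)
  also have "(\<Prod>e=1..M. ?G e ^ p e * (1 + ?T e) ^ ?q e)
        * (\<Prod>e=1..M. ?G e ^ (if even e then ?q (e div 2) else 0))
      = (\<Prod>e=1..M. ((1 + ?T e) * ?G e) ^ ?q e)"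
    unfolding prod.distrib[symmetric]
  proof (intro prod.cong refl)
    fix e assume "e \<in> {1..M}"
    then have "1 \<le> e" by simp
    from card_positive_necklaces[OF this, of m]
    have "p e + (if even e then ?q (e div 2) else 0) = ?q e"
      by (simp only: p_def q_def)
    then have "?G e ^ ?q e = ?G e ^ p e * ?G e ^ (if even e then ?q (e div 2) else 0)"
      by (simp only: power_add[symmetric])
    then show "?G e ^ p e * (1 + ?T e) ^ ?q e * ?G e ^ (if even e then ?q (e div 2) else 0)
        = ((1 + ?T e) * ?G e) ^ ?q e"
      by (simp only: power_mult_distrib mult_ac)
  qed
  finally have eq: "(\<Prod>N\<in>necklaces_upto (2 * m) M. necklace_series m N)
      = (\<Prod>e=1..M. ((1 + ?T e) * ?G e) ^ ?q e) * E" .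
  have "fps_nth E k = (if k = 0 then 1 else 0)" if "k \<le> M" for k
    unfolding E_def
  proof (rule fps_prod_nth_trivial[OF _ that])
    fix j k assume j: "j \<in> {M div 2<..M}" and k: "k \<le> M"
    have "fps_nth (\<Prod>i<?q j. ?G (2 * j)) k = (if k = 0 then 1 else 0)"
      by (rule fps_prod_nth_trivial[OF _ k]) (use j in \<open>auto simp: cycle_series_nth_less\<close>)
    then show "fps_nth (?G (2 * j) ^ ?q j) k = (if k = 0 then 1 else 0)" by simp
  qed
  then show ?thesis unfolding eq by (rule fps_mult_nth_trivial) (use assms(2) in auto)
qed

subsection \<open>The shelf shuffle\<close>

lemma sorted_labelling_shelf_outcome:
  assumes "\<And>c. c \<in> {1..n} \<Longrightarrow> l c \<in> {1..2 * m}"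
  shows "sorted_labelling (2 * m) n l (shelf_outcome m n l)"
  using shelf_outcome_permutes[OF assms] assms shelf_outcome_order[OF assms]
  by unfold_locales

text \<open>Independent uniform labels amount to a uniform choice among the
  \<open>(2 * m) ^ n\<close> label functions with default value 0 off the cards. Grouping these
  functions by outcome turns the sum over permutations into one over labellings.\<close>

lemma sum_shelf_shuffle:
  fixes g :: "(nat \<Rightarrow> nat) \<Rightarrow> xpoly"
  assumes "m \<ge> 1"
  shows "(\<Sum>w | w permutes {1..n}. xconst (pmf (shelf_shuffle m n) w) * g w)
    = (\<Sum>l\<in>PiE_dflt {1..n} 0 (\<lambda>_. {1..2 * m}). scale m ^ n * g (shelf_outcome m n l))"
proof -
  define L where "L = PiE_dflt {1..n} 0 (\<lambda>_. {1..2 * m})"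
  have fin: "finite L" unfolding L_def by (rule finite_PiE_dflt) auto
  have card: "card L = (2 * m) ^ n" unfolding L_def by (subst card_PiE_dflt) auto
  then have "L \<noteq> {}" using assms by (auto simp: card_eq_0_iff)
  have shuffle: "shelf_shuffle m n = map_pmf (shelf_outcome m n) (pmf_of_set L)"
    unfolding shelf_shuffle_def L_def using assms by (subst Pi_pmf_of_set) auto
  have pmf: "xconst (pmf (shelf_shuffle m n) w) = (\<Sum>l | l \<in> L \<and> shelf_outcome m n l = w. scale m ^ n)" for w
  proof -
    have "pmf (shelf_shuffle m n) w = card (L \<inter> shelf_outcome m n -` {w}) / card L"
      unfolding shuffle by (simp add: pmf_map measure_pmf_of_set[OF \<open>L \<noteq> {}\<close> fin])
    also have "L \<inter> shelf_outcome m n -` {w} = {l. l \<in> L \<and> shelf_outcome m n l = w}" by auto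
    also have "card {l. l \<in> L \<and> shelf_outcome m n l = w} / card L
        = (\<Sum>l | l \<in> L \<and> shelf_outcome m n l = w. (1 / (2 * real m)) ^ n)"
      by (simp add: card power_divide power_mult_distrib)
    finally show ?thesis by (simp only: xconst_sum xconst_power)
  qed
  have "(\<Sum>w | w permutes {1..n}. xconst (pmf (shelf_shuffle m n) w) * g w)
      = (\<Sum>w | w permutes {1..n}. \<Sum>l | l \<in> L \<and> shelf_outcome m n l = w. scale m ^ n * g (shelf_outcome m n l))"
    unfolding pmf sum_distrib_right by (intro sum.cong refl) simp
  also have "\<dots> = (\<Sum>l\<in>L. scale m ^ n * g (shelf_outcome m n l))"
  proof (rule sum.group[OF fin])
    show "shelf_outcome m n ` L \<subseteq> {w. w permutes {1..n}}"
      using shelf_outcome_permutes[of n _ m] by (auto simp: L_def PiE_dflt_def)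
  qed (simp add: finite_permutations)
  finally show ?thesis by (simp only: L_def)
qed

text \<open>Each labelling yields a multiset of necklaces through its counts. This map is injective
  by \<open>sorted_labelling_eqI\<close>, and both sides have \<open>(2 * m) ^ n\<close> elements,
  so it is a bijection that requires no explicit inverse. It carries the cycle monomial to a product
  of coefficients of necklace series.\<close>

lemma sum_shelf_labellings:
  assumes "n \<le> M"
  shows "(\<Sum>l\<in>PiE_dflt {1..n} 0 (\<lambda>_. {1..2 * m}).
      scale m ^ n * (\<Prod>i=1..n. xvar i ^ num_cycles n (shelf_outcome m n l) i))
    = fps_nth (\<Prod>N\<in>necklaces_upto (2 * m) M. necklace_series m N) n"
proof -
  define L where "L = PiE_dflt {1..n} 0 (\<lambda>_. {1..2 * m})"
  define W where "W = necklaces_upto (2 * m) M"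
  define count where "count l = sorted_labelling.neck_count n l (shelf_outcome m n l)" for l
  define d where "d l N = (if N \<in> W then count l N else 0)" for l N
  define D where "D = {d \<in> compositions_on W n. \<forall>N\<in>W. card N dvd d N}"
  have lab: "sorted_labelling (2 * m) n l (shelf_outcome m n l)" if "l \<in> L" for l
    by (rule sorted_labelling_shelf_outcome) (use that in \<open>simp add: L_def PiE_dflt_def\<close>)
  have finW: "finite W" by (simp add: W_def finite_necklaces_upto)
  have dvd: "card N dvd count l N" if l: "l \<in> L" and N_in: "N \<in> W" for l N
  proof -
    interpret sorted_labelling "2 * m" n l "shelf_outcome m n l" by (rule lab[OF l])
    obtain e where N: "N \<in> necklaces (2 * m) e"
      using N_in by (auto simp: W_def necklaces_upto_def)
    obtain x where "x \<in> N" using necklaces_nonempty[OF N] by auto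
    then show ?thesis
      using neck_count_eq[OF N] necklaces_eq_size[OF N] by (simp add: count_def)
  qed
  \<comment> \<open>Each card lies above exactly one necklace, the shift orbit of its word.\<close>
  have total: "(\<Sum>N\<in>W. count l N) = n" if "l \<in> L" for l
  proof -
    interpret sorted_labelling "2 * m" n l "shelf_outcome m n l" by (rule lab[OF that])
    have "(\<Sum>N\<in>W. count l N) = (\<Sum>N\<in>W. card {c \<in> {1..n}. orbit wshift (word c) = N})"
    proof (intro sum.cong refl)
      fix N assume "N \<in> W"
      then obtain e where N: "N \<in> necklaces (2 * m) e" by (auto simp: W_def necklaces_upto_def)
      have "word c \<in> N \<longleftrightarrow> orbit wshift (word c) = N" for c
        using word_image_eq_necklace_iff[OF N, of c] by (simp add: word_image_orbit)
      then show "count l N = card {c \<in> {1..n}. orbit wshift (word c) = N}"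
        by (simp only: count_def neck_count_def)
    qed
    also have "\<dots> = (\<Sum>N\<in>W. \<Sum>c | c \<in> {1..n} \<and> orbit wshift (word c) = N. 1)" by simp
    also have "\<dots> = (\<Sum>c\<in>{1..n}. 1)"
    proof (rule sum.group)
      show "(\<lambda>c. orbit wshift (word c)) ` {1..n} \<subseteq> W"
      proof (rule image_subsetI)
        fix c assume "c \<in> {1..n}"
        from necklace_of_card[OF this] obtain e
          where "1 \<le> e" "e \<le> n" "orbit wshift (word c) \<in> necklaces (2 * m) e" .
        then show "orbit wshift (word c) \<in> W"
          using assms unfolding W_def necklaces_upto_def by (intro UN_I[of e]) auto
      qed
    qed (use finW in auto)
    finally show ?thesis by simp
  qed
  have dD: "d l \<in> D" if "l \<in> L" for l
    using dvd[OF that] total[OF that] by (simp add: D_def compositions_on_def d_def)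
  have inj: "inj_on d L"
  proof (rule inj_onI)
    fix l l' assume l: "l \<in> L" "l' \<in> L" and eq: "d l = d l'"
    have "l c = l' c" if "c \<in> {1..n}" for c
    proof (rule sorted_labelling_eqI[OF lab[OF l(1)] lab[OF l(2)] _ that])
      fix e N assume N: "1 \<le> e" "e \<le> n" "N \<in> necklaces (2 * m) e"
      then have "N \<in> W" using assms unfolding W_def necklaces_upto_def by (intro UN_I[of e]) auto
      then show "sorted_labelling.neck_count n l (shelf_outcome m n l) N
          = sorted_labelling.neck_count n l' (shelf_outcome m n l') N"
        using fun_cong[OF eq, of N] by (simp add: d_def count_def)
    qed
    moreover have "l c = l' c" if "c \<notin> {1..n}" for c
      using l that by (simp add: L_def PiE_dflt_def)
    ultimately show "l = l'" by blast
  qed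
  have finD: "finite D" by (simp add: D_def finite_compositions_on finW)
  have "card L = (2 * m) ^ n" unfolding L_def by (subst card_PiE_dflt) auto
  also have "\<dots> = card D"
    unfolding D_def W_def by (rule card_divisible_compositions[OF assms, symmetric])
  finally have "card (d ` L) = card D" by (simp add: card_image[OF inj])
  then have image: "d ` L = D"
    using finD dD by (intro card_subset_eq) auto
  have "(\<Sum>l\<in>L. scale m ^ n * (\<Prod>i=1..n. xvar i ^ num_cycles n (shelf_outcome m n l) i))
      = (\<Sum>l\<in>L. \<Prod>N\<in>W. fps_nth (necklace_series m N) (d l N))"
  proof (intro sum.cong refl)
    fix l assume l: "l \<in> L"
    interpret sorted_labelling "2 * m" n l "shelf_outcome m n l" by (rule lab[OF l])
    have "(\<Prod>N\<in>W. fps_nth (necklace_series m N) (d l N))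
        = (\<Prod>N\<in>W. neck_weight xvar N (count l N div card N) * scale m ^ count l N)"
      using dvd[OF l] by (intro prod.cong refl) (simp add: necklace_series_def d_def)
    also have "\<dots> = (\<Prod>N\<in>W. neck_weight xvar N (count l N div card N)) * scale m ^ n"
      using total[OF l] by (simp add: prod.distrib power_sum[symmetric])
    also have "(\<Prod>N\<in>W. neck_weight xvar N (count l N div card N))
        = (\<Prod>i=1..n. xvar i ^ num_cycles n (shelf_outcome m n l) i)"
      using prod_num_cycles[OF assms, of xvar] by (simp add: W_def necklaces_upto_def count_def)
    finally show "scale m ^ n * (\<Prod>i=1..n. xvar i ^ num_cycles n (shelf_outcome m n l) i)
        = (\<Prod>N\<in>W. fps_nth (necklace_series m N) (d l N))" by (simp add: mult.commute)
  qed
  also have "\<dots> = (\<Sum>d\<in>D. \<Prod>N\<in>W. fps_nth (necklace_series m N) (d N))"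
    unfolding image[symmetric] by (simp add: sum.reindex[OF inj])
  \<comment> \<open>A composition outside \<open>D\<close> has some \<open>d N\<close> that is not a
    multiple of \<open>card N\<close>, where the coefficient of the necklace series is 0.\<close>
  also have "\<dots> = (\<Sum>d\<in>compositions_on W n. \<Prod>N\<in>W. fps_nth (necklace_series m N) (d N))"
  proof (rule sum.mono_neutral_left)
    show "\<forall>d\<in>compositions_on W n - D. (\<Prod>N\<in>W. fps_nth (necklace_series m N) (d N)) = 0"
      using finW by (auto simp: D_def necklace_series_def intro!: prod_zero)
  qed (auto simp: D_def finite_compositions_on finW)
  also have "\<dots> = fps_nth (\<Prod>N\<in>W. necklace_series m N) n"
    by (rule fps_prod_nth_compositions[OF finW, symmetric])
  finally show ?thesis by (simp only: L_def W_def)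
qed

theorem theorem3p6:
  fixes m :: nat
  assumes "m \<ge> 1"
  shows "(\<lambda>i. fps_rpow
              ((1 + cycle_term m (Suc i)) * fps_recip (1 - cycle_term m (Suc i)))
              (shelf_exponent (Suc i) m))
           has_prod
         (1 + Abs_fps (\<lambda>n. if n \<ge> 1
            then \<Sum>w | w permutes {1..n}.
                   xconst (pmf (shelf_shuffle m n) w) * (\<Prod>i = 1..n. xvar i ^ num_cycles n w i)
            else 0))"
    (is "?f has_prod ?P")
proof -
  define q where "q e = card (signed_necklaces (2 * m) e (-1))" for e
  have factor0: "fps_nth ((1 + cycle_term m e) * cycle_series m e) 0 = 1" if "e \<ge> 1" for e
    using that by (simp add: cycle_term_nth cycle_series_nth_less)
  \<comment> \<open>The exponent is the number of negative necklaces, so the binomial series is an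
    ordinary power.\<close>
  have f: "?f i = ((1 + cycle_term m (Suc i)) * cycle_series m (Suc i)) ^ q (Suc i)" for i
    using factor0[of "Suc i"]
    by (simp add: card_negative_necklaces q_def cycle_series_def fps_rpow_of_nat)
  have coeff: "fps_nth (\<Prod>i\<le>M. ?f i) n = fps_nth ?P n" if n: "n \<le> M" for n M
  proof -
    \<comment> \<open>The indices up to \<open>M\<close> stand for the cycle lengths
      \<open>1..Suc M\<close>, which include all lengths up to \<open>n\<close>.\<close>
    have prod: "(\<Prod>i\<le>M. ?f i) = (\<Prod>e=1..Suc M. ((1 + cycle_term m e) * cycle_series m e) ^ q e)"
      unfolding f by (simp add: prod.shift_bounds_cl_Suc_ivl atMost_atLeast0 del: prod.cl_ivl_Suc)
    show ?thesis
    proof (cases "n = 0")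
      case True
      have "fps_nth (\<Prod>i\<le>M. ?f i) 0 = (\<Prod>e=1..Suc M. 1)"
        unfolding prod fps_nth_prod_0 fps_power_zeroth
        by (intro prod.cong refl) (simp only: factor0 atLeastAtMost_iff power_one)
      then show ?thesis by (simp add: True)
    next
      case False
      then have "fps_nth ?P n = (\<Sum>w | w permutes {1..n}. xconst (pmf (shelf_shuffle m n) w)
          * (\<Prod>i=1..n. xvar i ^ num_cycles n w i))" by simp
      also have "\<dots> = fps_nth (\<Prod>N\<in>necklaces_upto (2 * m) (Suc M). necklace_series m N) n"
        unfolding sum_shelf_shuffle[OF assms] using n by (intro sum_shelf_labellings) simp
      also have "\<dots> = fps_nth (\<Prod>i\<le>M. ?f i) n"
        unfolding prod q_def using n by (intro prod_necklace_series) simp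
      finally show ?thesis ..
    qed
  qed
  have "(\<lambda>M. \<Prod>i\<le>M. ?f i) \<longlonglongrightarrow> ?P"
  proof (rule tendsto_fpsI)
    fix n
    show "\<forall>\<^sub>F M in sequentially. fps_nth (\<Prod>i\<le>M. ?f i) n = fps_nth ?P n"
      using eventually_ge_at_top[of n] by eventually_elim (rule coeff)
  qed
  \<comment> \<open>Convergence in the sense of \<open>raw_has_prod\<close> includes a nonzero
    limit; here the constant coefficient is 1.\<close>
  moreover have "?P \<noteq> 0"
  proof
    assume "?P = 0"
    then have "fps_nth ?P 0 = 0" by (simp only: fps_zero_nth)
    then show False by simp
  qed
  ultimately have "raw_has_prod ?f 0 ?P" by (simp add: raw_has_prod_def)
  then show ?thesis by (simp add: has_prod_def)
qed

end
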